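(* Let $p$ and $q$ be distinct primes with $\gcd(p-1,q-1)=4$, and let $g,h,e$, the classes $D_0,\dots,D_3$, the polynomials $D_k(X)$, the quaternary sequence $(e_u)$ over $\mathbb{Z}_4$ and the (generalized) trace functions be as defined in the context. Let $\ell$, $\ell_p$, $\ell_q$ be the multiplicative orders of $2$ modulo $pq$, modulo $p$ and modulo $q$, respectively. Let $\beta\in GR(4,4^{\ell})$ be a primitive $pq$-th root of unity and let $\rho=D_1(\beta)+2D_2(\beta)+3D_3(\beta)$. Then for all $u\ge 0$ $$e_u=2+2\sum_{i=0}^{\frac{p-1}{\ell_p}-1}\mathrm{TR}_1^{\ell_p}\left(\beta^{ug^iq}\right)+2\sum_{i=0}^{\frac{q-1}{\ell_q}-1}\mathrm{TR}_1^{\ell_q}\left(\beta^{ug^ip}\right)+\sum_{j=0}^{3}(\rho+2-j)\sum_{i=0}^{\frac{4e}{\ell}-1}\mathrm{TR}_4^{\ell}\left(\beta^{ug^ih^j}\right)$$ if $p\equiv 1\pmod 8$ and $q\equiv 5\pmod 8$, while $$e_u=2+\sum_{j=0}^{3}(\rho+2-j)\sum_{i=0}^{\frac{4e}{\ell}-1}\mathrm{TR}_4^{\ell}\left(\beta^{ug^ih^j}\right)$$ if $p\equiv 5\pmod 8$ and $q\equiv 1\pmod 8$.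
   Context: $\mathbb{Z}_m=\{0,1,\dots,m-1\}$ is the residue class ring modulo $m$. $p,q$ are distinct primes with $\gcd(p-1,q-1)=4$, and $e=(p-1)(q-1)/4$. Fix an integer $g$ that is a common primitive root of both $p$ and $q$, and an integer $h$ with $h\equiv g\pmod p$, $h\equiv 1\pmod q$. The generalized cyclotomic classes of order $4$ modulo $pq$ are $D_i=\{g^sh^i \bmod pq: s=0,1,\dots,e-1\}\subseteq\{0,\dots,pq-1\}$ for $0\le i<4$; they partition $\mathbb{Z}_{pq}^*$. Put $D_i(X)=\sum_{u\in D_i}X^u\in\mathbb{Z}_4[X]$. Let $P=\{p,2p,\dots,(q-1)p\}$, $Q=\{q,2q,\dots,(p-1)q\}$, $R=\{0\}$. The sequence $(e_u)_{u\ge 0}$ over $\mathbb{Z}_4$ of period $pq$ is: $e_u=2$ if $u\bmod pq\in Q\cup R$; $e_u=0$ if $u\bmod pq\in P$; $e_u=i$ if $u\bmod pq\in D_i$, $i=0,1,2,3$. $GR(4,4^r)$ is the Galois ring $\mathbb{Z}_4[X]/(f(X))$ of characteristic $4$ with $4^r$ elements, where $f$ has degree $r$ and is irreducible modulo $2$; for $s\mid r$, $GR(4,4^s)$ is regarded as a subring of $GR(4,4^r)$. A primitive $pq$-th root of unity is a unit of multiplicative order exactly $pq$. The Teichmuller set of $GR(4,4^r)$ is $\mathcal{T}=\{0,1,\xi,\dots,\xi^{2^r-2}\}$, where $\xi$ is a unit of order $2^r-1$; every element of $GR(4,4^r)$ is uniquely $\alpha_1+2\alpha_2$ with $\alpha_1,\alpha_2\in\mathcal{T}$.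 For $s\mid r$, the generalized Frobenius automorphism of $GR(4,4^r)$ over $GR(4,4^s)$ is $\Phi_s(\alpha_1+2\alpha_2)=\alpha_1^{2^s}+2\alpha_2^{2^s}$ ($\alpha_1,\alpha_2\in\mathcal{T}$), and the generalized trace function $\mathrm{TR}_s^r:GR(4,4^r)\to GR(4,4^s)$ is $\mathrm{TR}_s^r(\alpha)=\sum_{k=0}^{r/s-1}\Phi_s^k(\alpha)$. (For $s=1$ this is the trace function to $\mathbb{Z}_4$. In particular, $\mathrm{TR}_s^r(\alpha_1)=\alpha_1+\alpha_1^{2^s}+\dots+\alpha_1^{2^{s(r/s-1)}}$ for $\alpha_1\in\mathcal{T}$.) The powers of $\beta^q$ lie in $GR(4,4^{\ell_p})$ and the powers of $\beta^p$ lie in $GR(4,4^{\ell_q})$. In both cases of the claim, $4\mid\ell$, so $\mathrm{TR}_4^{\ell}$ is defined. *)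

theory Defs
  imports
    "HOL-Library.Z2"
    "HOL-Library.Numeral_Type"
    "HOL-Number_Theory.Number_Theory"
    "HOL-Computational_Algebra.Polynomial"
begin

text \<open>
  The ring of integers modulo 4 is the numeral type \<open>4\<close>; \<open>Rep_bit0\<close> sends a residue class to its
  representative in \<open>{0, 1, 2, 3}\<close>. The map \<open>Z4_emb\<close> is a ring homomorphism when \<open>4 = 0\<close>
  in the target ring.
\<close>

definition Z4_emb :: "4 \<Rightarrow> 'a::comm_ring_1" where
  "Z4_emb x = of_int (Rep_bit0 x)"

definition red2 :: "4 \<Rightarrow> bit" where
  "red2 = Z4_emb"


subsection \<open>Units\<close>

text \<open>The first two conjuncts already force \<open>x\<close> to be a unit.\<close>

definition has_mult_order :: "'a::comm_ring_1 \<Rightarrow> nat \<Rightarrow> bool" where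
  "has_mult_order x n \<longleftrightarrow> 0 < n \<and> x ^ n = 1 \<and> (\<forall>m. 0 < m \<and> m < n \<longrightarrow> x ^ m \<noteq> 1)"

definition unit_powi :: "'a::comm_ring_1 \<Rightarrow> int \<Rightarrow> 'a" where
  "unit_powi x k = (if 0 \<le> k then x ^ nat k else (THE y. x * y = 1) ^ nat (- k))"


subsection \<open>Galois rings\<close>

text \<open>
  \<open>galois_ring r K\<close> says that \<open>K\<close> is a subring (with the same unit element) of the ambient ring
  and is isomorphic to \<open>\<int>\<^sub>4[X]/(f)\<close> for some \<open>f\<close> of degree \<open>r\<close> that is irreducible modulo 2:
  \<open>K\<close> is the image of a ring homomorphism from \<open>\<int>\<^sub>4[X]\<close> with kernel \<open>(f)\<close>.
  The ambient ring itself is the case \<open>K = UNIV\<close>. Taking \<open>f\<close> monic only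
  fixes its sign, since the leading coefficient has to be a unit of \<open>\<int>\<^sub>4\<close>.
\<close>

definition galois_ring :: "nat \<Rightarrow> 'a::comm_ring_1 set \<Rightarrow> bool" where
  "galois_ring r K \<longleftrightarrow>
     (\<exists>(f :: 4 poly) (\<phi> :: 4 poly \<Rightarrow> 'a).
        lead_coeff f = 1 \<and> degree f = r \<and> irreducible (map_poly red2 f) \<and>
        \<phi> 1 = 1 \<and> (\<forall>a b. \<phi> (a + b) = \<phi> a + \<phi> b) \<and> (\<forall>a b. \<phi> (a * b) = \<phi> a * \<phi> b) \<and>
        range \<phi> = K \<and> (\<forall>a. \<phi> a = 0 \<longleftrightarrow> f dvd a))"

text \<open>
  In the following, \<open>K\<close> is a Galois ring with \<open>4 ^ r\<close> elements. The Teichmueller set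
  does not depend on the choice of the unit of order \<open>2 ^ r - 1\<close>.
\<close>

definition teichmueller :: "'a::comm_ring_1 set \<Rightarrow> nat \<Rightarrow> 'a set" where
  "teichmueller K r =
     (let \<xi> = (SOME x. x \<in> K \<and> has_mult_order x (2 ^ r - 1))
      in insert 0 {\<xi> ^ i | i. i < 2 ^ r - 1})"

definition frob :: "'a::comm_ring_1 set \<Rightarrow> nat \<Rightarrow> nat \<Rightarrow> 'a \<Rightarrow> 'a" where
  "frob K r s \<alpha> =
     (let (a1, a2) = (THE (a1, a2). a1 \<in> teichmueller K r \<and> a2 \<in> teichmueller K r \<and>
                                    \<alpha> = a1 + 2 * a2)
      in a1 ^ (2 ^ s) + 2 * a2 ^ (2 ^ s))"

text \<open>\<open>TR K s r\<close> is the generalized trace from \<open>K\<close>, of degree \<open>r\<close>, to its Galois subring of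
  degree \<open>s\<close>, where \<open>s\<close> divides \<open>r\<close>.\<close>

definition TR :: "'a::comm_ring_1 set \<Rightarrow> nat \<Rightarrow> nat \<Rightarrow> 'a \<Rightarrow> 'a" where
  "TR K s r \<alpha> = (\<Sum>k < r div s. (frob K r s ^^ k) \<alpha>)"


subsection \<open>Generalized cyclotomic classes of order 4 and the quaternary sequence\<close>

definition cyc_e :: "nat \<Rightarrow> nat \<Rightarrow> nat" where
  "cyc_e p q = (p - 1) * (q - 1) div 4"

definition cyc_class :: "nat \<Rightarrow> nat \<Rightarrow> int \<Rightarrow> int \<Rightarrow> nat \<Rightarrow> nat set" where
  "cyc_class p q g h i = {nat ((g ^ s * h ^ i) mod int (p * q)) | s. s < cyc_e p q}"

text \<open>The coefficients 0 and 1 are taken in an arbitrary ring, so that the polynomial can be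
  evaluated in an extension of \<open>\<int>\<^sub>4\<close>.\<close>

definition cyc_poly :: "nat \<Rightarrow> nat \<Rightarrow> int \<Rightarrow> int \<Rightarrow> nat \<Rightarrow> 'a::comm_ring_1 poly" where
  "cyc_poly p q g h i = (\<Sum>u \<in> cyc_class p q g h i. Polynomial.monom 1 u)"

definition P_set :: "nat \<Rightarrow> nat \<Rightarrow> nat set" where
  "P_set p q = {k * p | k. 1 \<le> k \<and> k \<le> q - 1}"

definition Q_set :: "nat \<Rightarrow> nat \<Rightarrow> nat set" where
  "Q_set p q = {k * q | k. 1 \<le> k \<and> k \<le> p - 1}"

definition R_set :: "nat set" where
  "R_set = {0}"

definition quat_seq :: "nat \<Rightarrow> nat \<Rightarrow> int \<Rightarrow> int \<Rightarrow> nat \<Rightarrow> 4" where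
  "quat_seq p q g h u =
     (if u mod (p * q) \<in> Q_set p q \<union> R_set then 2
      else if u mod (p * q) \<in> P_set p q then 0
      else of_nat (THE i. i < 4 \<and> u mod (p * q) \<in> cyc_class p q g h i))"

text \<open>A primitive root may be any integer, while \<^const>\<open>residue_primroot\<close> expects a natural number.\<close>

definition int_primroot :: "nat \<Rightarrow> int \<Rightarrow> bool" where
  "int_primroot n g \<longleftrightarrow> residue_primroot n (nat (g mod int n))"

end

theory Submission
  imports Defs "HOL-Computational_Algebra.Polynomial_Factorial"
begin

text \<open>
  Powers of \<open>\<beta>\<close> lie in the Teichmueller set, so a generalized trace of such a power is a sum
  over a coset of \<open>\<langle>2\<rangle>\<close> modulo \<open>p\<close> or \<open>q\<close>, or of \<open>\<langle>16\<rangle>\<close> modulo \<open>p q\<close>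
  (here \<open>16\<close> lies in \<open>D\<^sub>0 = \<langle>g\<rangle>\<close> because \<open>h ^ 4\<close> does). The inner sums over \<open>i\<close> collect
  these cosets into sums over all nonzero residues and into the values \<open>D\<^sub>j(\<beta> ^ u)\<close>. If \<open>u\<close> is in
  \<open>D\<^sub>i\<close>, then \<open>D\<^sub>j(\<beta> ^ u) = D\<^sub>i\<^sub>+\<^sub>j(\<beta>)\<close>, and since
  the four values \<open>D\<^sub>k(\<beta>)\<close> add up to \<open>\<mu>(p q) = 1\<close>, the weights \<open>\<rho> + 2 - j\<close> turn the sum into
  \<open>\<rho> + 2 - (\<rho> - i) = i + 2\<close>. If \<open>p\<close> or \<open>q\<close> divides \<open>u\<close>, then \<open>D\<^sub>j(\<beta> ^ u)\<close> does not
  depend on \<open>j\<close>. That 4 divides the order of 2 follows from 2 being a non-residue modulo the prime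
  that is 5 modulo 8.
\<close>

subsection \<open>Reduction modulo 2\<close>

text \<open>The Galois rings are known only through a presentation, so the work starts with a form
  of reduction modulo 2 that stays inside the ring. In Z_4[X] and in its quotients the annihilator
  of 2 is the ideal generated by 2; hence \<open>2 * x\<close> carries exactly the residue of
  \<open>x\<close>, and \<open>2 * x = 2 * y\<close> expresses a congruence modulo 2. Zero divisors
  are the main obstacle: a geometric sum can be cancelled only after the other factor is shown to be
  nonzero modulo 2, and roots of X^(2^s) - X are counted through their residues. That count also
  places the powers of \<open>\<beta> ^ q\<close> and \<open>\<beta> ^ p\<close> in
  \<open>Kp\<close> and \<open>Kq\<close>, a membership that has to be derived.

  The congruences modulo 8 have a second role. If \<open>p\<close> or \<open>q\<close> divides
  \<open>u\<close>, the weighted sum is twice the common value of the periods, so it depends only on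
  a parity, that of \<open>(p - 1) div 4\<close> or \<open>(q - 1) div 4\<close>. For
  \<open>p = 5\<close>, \<open>q = 1\<close> modulo 8 this already separates P from Q; in the other
  case the parities are exchanged, and the two trace sums for the primes repair this by adding 2
  exactly on P and Q.\<close>

lemma Rep_bit0_of_int: "Rep_bit0 (of_int a :: 4) = a mod 4"
proof -
  have "Rep_bit0 (of_int a :: 4) = a mod int CARD(4)"
    by (simp only: bit0.of_int_eq bit0.Rep_Abs_mod)
  then show ?thesis by simp
qed

lemma of_int_four_eq_0_iff: "(of_int a :: 4) = 0 \<longleftrightarrow> 4 dvd a"
proof -
  have "(of_int a :: 4) = 0 \<longleftrightarrow> Rep_bit0 (of_int a :: 4) = Rep_bit0 (0 :: 4)"
    by (simp only: Rep_bit0_inject)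
  also have "\<dots> \<longleftrightarrow> a mod 4 = 0"
    by (simp add: Rep_bit0_of_int bit0.Rep_0)
  finally show ?thesis by (simp add: dvd_eq_mod_eq_0)
qed

lemma Z4_emb_of_int:
  assumes "(4 :: 'a::comm_ring_1) = 0"
  shows "Z4_emb (of_int a) = (of_int a :: 'a)"
proof -
  have "(of_int a :: 'a) = of_int (4 * (a div 4) + a mod 4)"
    by simp
  moreover have "\<dots> = of_int (a mod 4)"
    by (simp only: of_int_add of_int_mult of_int_numeral assms mult_zero_left add_0)
  ultimately show ?thesis by (simp add: Z4_emb_def Rep_bit0_of_int)
qed

lemma red2_of_int: "red2 (of_int a) = of_int a"
  unfolding red2_def by (rule Z4_emb_of_int) simp

lemma red2_0: "red2 0 = 0"
  using red2_of_int[of 0] by simp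

lemma red2_1: "red2 1 = 1"
  using red2_of_int[of 1] by simp

lemma four_cases: obtains a where "(x :: 4) = of_int a"
  by (cases x) auto

lemma red2_add: "red2 (x + y) = red2 x + red2 y"
proof -
  obtain a b where "x = of_int a" "y = of_int b" by (meson four_cases)
  then show ?thesis using red2_of_int[of "a + b"] by (simp add: red2_of_int)
qed

lemma red2_mult: "red2 (x * y) = red2 x * red2 y"
proof -
  obtain a b where "x = of_int a" "y = of_int b" by (meson four_cases)
  then show ?thesis using red2_of_int[of "a * b"] by (simp add: red2_of_int)
qed

lemma of_int_bit_eq_0_iff: "(of_int a :: bit) = 0 \<longleftrightarrow> even a"
proof -
  obtain k where "a = 2 * k \<or> a = 2 * k + 1" by (metis oddE evenE)
  then show ?thesis by auto
qed

lemma red2_eq_0_iff: "red2 x = 0 \<longleftrightarrow> 2 * x = 0"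
proof -
  obtain a where a: "x = of_int a" by (meson four_cases)
  have "2 * x = of_int (2 * a)" by (simp add: a)
  then have "2 * x = 0 \<longleftrightarrow> 4 dvd 2 * a" by (simp only: of_int_four_eq_0_iff)
  also have "\<dots> \<longleftrightarrow> even a" by presburger
  finally show ?thesis by (simp add: a red2_of_int of_int_bit_eq_0_iff)
qed

lemma red2_eq_0_imp_even:
  assumes "red2 x = 0"
  obtains y where "x = 2 * y"
proof -
  obtain a where a: "x = of_int a" by (meson four_cases)
  with assms obtain b where "a = 2 * b"
    by (auto simp: red2_of_int of_int_bit_eq_0_iff elim: evenE)
  with a have "x = 2 * of_int b" by simp
  then show thesis by (rule that)
qed

abbreviation redp :: "4 poly \<Rightarrow> bit poly" where
  "redp \<equiv> map_poly red2"

lemma coeff_redp: "coeff (redp a) n = red2 (coeff a n)"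
  by (simp add: coeff_map_poly red2_0)

lemma red2_sum: "red2 (sum f A) = (\<Sum>x\<in>A. red2 (f x))"
  by (induction A rule: infinite_finite_induct) (auto simp: red2_0 red2_add)

lemma redp_add: "redp (a + b) = redp a + redp b"
  by (rule poly_eqI) (simp add: coeff_redp red2_add)

lemma redp_mult: "redp (a * b) = redp a * redp b"
  by (rule poly_eqI) (simp add: coeff_redp coeff_mult red2_sum red2_mult)

lemma redp_diff: "redp (a - b) = redp a - redp b"
  using redp_add[of "a - b" b] by (simp add: algebra_simps)

lemma redp_eq_0_iff: "redp a = 0 \<longleftrightarrow> 2 * a = 0"
proof -
  have "coeff (2 * a) n = 2 * coeff a n" for n
    by (simp only: mult_2 coeff_add)
  then have "2 * a = 0 \<longleftrightarrow> (\<forall>n. 2 * coeff a n = 0)"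
    by (simp only: poly_eq_iff coeff_0)
  then show ?thesis
    by (simp only: poly_eq_iff coeff_redp red2_eq_0_iff coeff_0)
qed

lemma surj_redp: obtains b where "redp b = (a :: bit poly)"
proof
  show "redp (map_poly (\<lambda>x. if x = 0 then 0 else 1) a) = a"
    by (rule poly_eqI) (simp add: coeff_redp coeff_map_poly red2_0 red2_1)
qed

lemma redp_eq_0_imp_even:
  assumes "redp a = 0"
  obtains b where "a = 2 * b"
proof
  \<comment> \<open>The value at 0 is prescribed, because a choice could return 2 there, while the
    coefficients of \<open>map_poly\<close> are given by the map only if it fixes 0.\<close>
  define half where "half x = (if x = 0 then 0 else SOME y. x = 2 * y)" for x :: 4
  have half: "2 * half x = x" if x: "red2 x = 0" for x
  proof (cases "x = 0")
    case False
    obtain y where "x = 2 * y" using x by (rule red2_eq_0_imp_even)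
    then have "x = 2 * (SOME y. x = 2 * y)" by (rule someI)
    with False show ?thesis by (simp only: half_def if_False)
  qed (simp add: half_def)
  show "a = 2 * map_poly half a"
  proof (rule poly_eqI)
    fix n
    have "red2 (coeff a n) = 0" using assms by (metis coeff_redp coeff_0)
    then have "coeff a n = 2 * half (coeff a n)" by (rule half [symmetric])
    moreover have "coeff (map_poly half a) n = half (coeff a n)"
      by (rule coeff_map_poly) (simp add: half_def)
    ultimately show "coeff a n = coeff (2 * map_poly half a) n"
      by (metis coeff_add mult_2)
  qed
qed

lemma double_double_eq_0: "2 * (2 * a) = (0 :: 4 poly)"
proof (rule poly_eqI)
  fix n
  have "coeff (2 * (2 * a)) n = (2 * 2) * coeff a n"
    by (simp only: mult_2 coeff_add distrib_right)
  also have "(2 * 2 :: 4) = 0" by simp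
  finally show "coeff (2 * (2 * a)) n = coeff 0 n" by simp
qed

text \<open>Doubling turns divisibility modulo 2 into an exact statement over Z_4. In the forward
  direction a second doubling kills the left side, so \<open>redp f * redp c = 0\<close>; bit
  polynomials have no zero divisors, hence the cofactor \<open>c\<close> is even and a 2 can be
  removed from both sides modulo 2.\<close>

lemma dvd_double_iff:
  assumes "redp f \<noteq> 0"
  shows "f dvd 2 * a \<longleftrightarrow> redp f dvd redp a"
proof
  assume "f dvd 2 * a"
  then obtain c where c: "2 * a = f * c" by (auto elim: dvdE)
  have "2 * (2 * a) = 0" by (rule double_double_eq_0)
  then have "redp (2 * a) = 0" by (simp only: redp_eq_0_iff)
  then have "redp c = 0" using assms by (simp add: c redp_mult)
  then obtain d where d: "c = 2 * d" by (rule redp_eq_0_imp_even)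
  have "2 * (a - f * d) = 0" using c d by (simp add: algebra_simps)
  then have "redp (a - f * d) = 0" by (simp only: redp_eq_0_iff)
  then have "redp a = redp f * redp d" by (simp add: redp_diff redp_mult)
  then show "redp f dvd redp a" by simp
next
  assume "redp f dvd redp a"
  then obtain c where c: "redp a = redp f * c" by (auto elim: dvdE)
  obtain d where "redp d = c" by (rule surj_redp)
  with c have "redp (a - f * d) = 0" by (simp add: redp_diff redp_mult)
  then have "2 * (a - f * d) = 0" by (simp only: redp_eq_0_iff)
  then have "2 * a = f * (2 * d)" by (simp add: algebra_simps)
  then show "f dvd 2 * a" by simp
qed

text \<open>A polynomial over the field with two elements is its support. The bound is on
  coefficients, since the zero polynomial has degree 0 and would be lost at \<open>r = 0\<close>
  under a bound on the degree.\<close>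

lemma card_bit_polys_degree_less:
  "card {g :: bit poly. \<forall>i\<ge>r. coeff g i = 0} = 2 ^ r"
proof -
  have "bij_betw (\<lambda>g. {i. coeff g i \<noteq> (0 :: bit)}) {g. \<forall>i\<ge>r. coeff g i = 0} (Pow {..<r})"
  proof (rule bij_betw_byWitness[where f' = "\<lambda>S. \<Sum>i\<in>S. monom 1 i"])
    have coeff_S: "coeff (\<Sum>i\<in>S. monom (1 :: bit) i) n = (if n \<in> S then 1 else 0)"
      if "S \<subseteq> {..<r}" for S n
      using finite_subset[OF that] by (simp add: coeff_sum sum.delta')
    show "\<forall>g\<in>{g :: bit poly. \<forall>i\<ge>r. coeff g i = 0}. (\<Sum>i\<in>{i. coeff g i \<noteq> 0}. monom 1 i) = g"
    proof
      fix g :: "bit poly" assume "g \<in> {g. \<forall>i\<ge>r. coeff g i = 0}"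
      then have "{i. coeff g i \<noteq> 0} \<subseteq> {..<r}" by (auto simp: not_less[symmetric])
      then show "(\<Sum>i\<in>{i. coeff g i \<noteq> 0}. monom 1 i) = g"
        by (intro poly_eqI) (auto simp: coeff_S)
    qed
    show "\<forall>S\<in>Pow {..<r}. {i. coeff (\<Sum>i\<in>S. monom (1 :: bit) i) i \<noteq> 0} = S"
      by (auto simp: coeff_S split: if_splits)
    show "(\<lambda>g. {i. coeff g i \<noteq> (0 :: bit)}) ` {g. \<forall>i\<ge>r. coeff g i = 0} \<subseteq> Pow {..<r}"
      by (auto simp: not_less[symmetric])
    show "(\<lambda>S. \<Sum>i\<in>S. monom (1 :: bit) i) ` Pow {..<r} \<subseteq> {g. \<forall>i\<ge>r. coeff g i = 0}"
      by (force simp: coeff_S)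
  qed
  then show ?thesis by (simp add: bij_betw_same_card card_Pow)
qed

subsection \<open>Galois rings\<close>

text \<open>These facts replace the presentation from here on. The last three say that
  \<open>2K\<close> is a prime ideal of \<open>K\<close>, that it is the annihilator of 2 in
  \<open>K\<close>, and that K/2K, being isomorphic to \<open>2K\<close> by doubling, has
  \<open>2 ^ r\<close> elements. Closure under negation comes from \<open>- x = x + x + x\<close> in
  characteristic 4.\<close>

locale galois_subring =
  fixes K :: "'a::comm_ring_1 set" and r :: nat
  assumes zero_mem: "0 \<in> K" and one_mem: "1 \<in> K"
    and add_mem: "x \<in> K \<Longrightarrow> y \<in> K \<Longrightarrow> x + y \<in> K"
    and mult_mem: "x \<in> K \<Longrightarrow> y \<in> K \<Longrightarrow> x * y \<in> K"
    and four_eq_0: "(4 :: 'a) = 0"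
    and two_neq_0: "(2 :: 'a) \<noteq> 0"
    and double_mult_eq_0: "x \<in> K \<Longrightarrow> y \<in> K \<Longrightarrow> 2 * (x * y) = 0 \<Longrightarrow> 2 * x = 0 \<or> 2 * y = 0"
    and double_eq_0: "x \<in> K \<Longrightarrow> 2 * x = 0 \<Longrightarrow> \<exists>y\<in>K. x = 2 * y"
    and card_double: "card ((*) 2 ` K) = 2 ^ r"

lemma galois_ring_imp_subring:
  fixes K :: "'a::comm_ring_1 set"
  assumes "galois_ring r K"
  shows "galois_subring K r"
proof -
  obtain f :: "4 poly" and \<phi> :: "4 poly \<Rightarrow> 'a" where
    monic: "lead_coeff f = 1" and deg: "degree f = r" and irred: "irreducible (redp f)" and
    \<phi>1: "\<phi> 1 = 1" and \<phi>_add: "\<And>a b. \<phi> (a + b) = \<phi> a + \<phi> b" and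
    \<phi>_mult: "\<And>a b. \<phi> (a * b) = \<phi> a * \<phi> b" and
    range: "range \<phi> = K" and kernel: "\<And>a. \<phi> a = 0 \<longleftrightarrow> f dvd a"
    using assms unfolding galois_ring_def by blast
  have nz: "redp f \<noteq> 0" using irred by (auto simp: irreducible_def)
  have prime: "prime_elem (redp f)" using irred by (rule field_poly_irreducible_imp_prime)
  have not_unit: "\<not> redp f dvd 1" using irred by (auto simp: irreducible_def)
  have \<phi>2: "\<phi> (2 * a) = 2 * \<phi> a" for a by (simp only: mult_2 \<phi>_add)
  have \<phi>0: "\<phi> 0 = 0" using kernel by simp
  have double_iff: "2 * \<phi> a = 0 \<longleftrightarrow> redp f dvd redp a" for a
    using kernel[of "2 * a"] dvd_double_iff[OF nz] by (simp only: \<phi>2)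
  have \<phi>_diff: "\<phi> (a - b) = \<phi> a - \<phi> b" for a b
    using \<phi>_add[of "a - b" b] by (simp add: algebra_simps)
  show ?thesis
  proof
    show "0 \<in> K" "1 \<in> K" using \<phi>0 \<phi>1 range by (metis rangeI)+
    show "x + y \<in> K" if "x \<in> K" "y \<in> K" for x y
      using that unfolding range[symmetric] by (auto simp flip: \<phi>_add)
    show "x * y \<in> K" if "x \<in> K" "y \<in> K" for x y
      using that unfolding range[symmetric] by (auto simp flip: \<phi>_mult)
    have "2 * (2 * \<phi> 1) = 0" by (simp only: flip: \<phi>2) (simp only: double_double_eq_0 \<phi>0)
    then show "(4 :: 'a) = 0" by (simp add: \<phi>1)
    show "(2 :: 'a) \<noteq> 0"
    proof
      assume "(2 :: 'a) = 0"
      then have "redp f dvd redp 1" using double_iff[of 1] by (simp add: \<phi>1)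
      moreover have "redp 1 = 1" by (simp add: poly_eq_iff coeff_redp red2_1 red2_0)
      ultimately show False using not_unit by simp
    qed
    show "2 * x = 0 \<or> 2 * y = 0" if K: "x \<in> K" "y \<in> K" and xy: "2 * (x * y) = 0" for x y
    proof -
      obtain a b where ab: "x = \<phi> a" "y = \<phi> b" using K range by blast
      then have "redp f dvd redp a * redp b"
        using xy double_iff[of "a * b"] by (simp add: \<phi>_mult redp_mult)
      then show ?thesis using prime double_iff ab by (auto simp: prime_elem_dvd_mult_iff)
    qed
    show "\<exists>y\<in>K. x = 2 * y" if x: "x \<in> K" "2 * x = 0" for x
    proof -
      obtain a where a: "x = \<phi> a" using x range by blast
      then obtain c where c: "redp a = redp f * c"
        using x double_iff by (auto elim: dvdE)
      obtain d where "redp d = c" by (rule surj_redp)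
      with c have "redp (a - f * d) = 0" by (simp add: redp_diff redp_mult)
      then obtain b where b: "a - f * d = 2 * b" by (rule redp_eq_0_imp_even)
      have "\<phi> (f * d) = 0" using kernel by simp
      then have "x = \<phi> (a - f * d)" by (simp add: a \<phi>_diff)
      then have "x = 2 * \<phi> b" by (simp only: b \<phi>2)
      then show ?thesis using range by blast
    qed
    \<comment> \<open>Remainders modulo \<open>redp f\<close> represent the residues. The lift taken
      by \<open>SOME\<close> does not matter, since \<open>2 * \<phi> a\<close> depends only on
      \<open>redp a\<close> modulo \<open>redp f\<close>.\<close>
    have "bij_betw (\<lambda>g. 2 * \<phi> (SOME a. redp a = g)) {g. \<forall>i\<ge>r. coeff g i = 0} ((*) 2 ` K)"
    proof -
      have lift: "redp (SOME a. redp a = g) = g" for g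
        using surj_redp[of g] someI_ex[of "\<lambda>a. redp a = g"] by blast
      have eq_iff: "2 * \<phi> a = 2 * \<phi> b \<longleftrightarrow> redp f dvd redp a - redp b" for a b
        using double_iff[of "a - b"] by (simp add: \<phi>_diff redp_diff algebra_simps)
      have deg_f: "degree (redp f) = r"
        using monic deg map_poly_degree_eq[of red2 f] by (simp add: red2_1)
      have r_pos: "r > 0"
        using is_unit_iff_degree[OF nz] not_unit deg_f by (cases r) auto
      have small: "(\<forall>i\<ge>r. coeff g i = 0) \<longleftrightarrow> degree g < r" for g :: "bit poly"
      proof
        assume "\<forall>i\<ge>r. coeff g i = 0"
        then have "r \<le> degree g \<Longrightarrow> g = 0" by (metis leading_coeff_0_iff)
        then show "degree g < r" using r_pos by (metis degree_0 not_le)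
      next
        assume "degree g < r"
        then show "\<forall>i\<ge>r. coeff g i = 0" by (meson coeff_eq_0 less_le_trans)
      qed
      show ?thesis
        unfolding bij_betw_def
      proof (intro conjI inj_onI equalityI subsetI)
        fix g g' :: "bit poly"
        assume g: "g \<in> {g. \<forall>i\<ge>r. coeff g i = 0}" "g' \<in> {g. \<forall>i\<ge>r. coeff g i = 0}"
          and eq: "2 * \<phi> (SOME a. redp a = g) = 2 * \<phi> (SOME a. redp a = g')"
        have "redp f dvd g - g'" using eq by (simp only: eq_iff lift)
        moreover have "degree (g - g') < degree (redp f)"
          using g small[of "g - g'"] deg_f by simp
        ultimately have "g - g' = 0" using dvd_imp_degree_le by (metis not_le)
        then show "g = g'" by simp
      next
        fix y assume "y \<in> (*) 2 ` K"
        then obtain a where a: "y = 2 * \<phi> a" using range by blast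
        have "redp f dvd redp a - redp a mod redp f" by (simp add: dvd_minus_mod)
        then have "y = 2 * \<phi> (SOME b. redp b = redp a mod redp f)"
          by (simp add: a eq_iff lift)
        moreover have "degree (redp a mod redp f) < r"
          using degree_mod_less[OF nz, of "redp a"] deg_f r_pos by (metis degree_0)
        ultimately show "y \<in> (\<lambda>g. 2 * \<phi> (SOME a. redp a = g)) ` {g. \<forall>i\<ge>r. coeff g i = 0}"
          using small by blast
      next
        fix y assume "y \<in> (\<lambda>g. 2 * \<phi> (SOME a. redp a = g)) ` {g. \<forall>i\<ge>r. coeff g i = 0}"
        then show "y \<in> (*) 2 ` K" using range by blast
      qed
    qed
    then show "card ((*) 2 ` K) = 2 ^ r"
      using bij_betw_same_card card_bit_polys_degree_less[of r] by fastforce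
  qed
qed

section \<open>Elements of finite multiplicative order\<close>

lemma has_mult_order_power_eq_iff:
  assumes "has_mult_order x n"
  shows "x ^ i = x ^ (i mod n)" and "x ^ m = 1 \<longleftrightarrow> n dvd m"
proof -
  have n: "n > 0" "x ^ n = 1" "\<And>m. 0 < m \<Longrightarrow> m < n \<Longrightarrow> x ^ m \<noteq> 1"
    using assms by (auto simp: has_mult_order_def)
  have red: "x ^ i = x ^ (i mod n)" for i
  proof -
    have "x ^ i = x ^ (n * (i div n) + i mod n)" by simp
    also have "\<dots> = x ^ (i mod n)" by (simp only: power_add power_mult n power_one mult_1)
    finally show ?thesis .
  qed
  then show "x ^ i = x ^ (i mod n)" .
  show "x ^ m = 1 \<longleftrightarrow> n dvd m"
    using red[of m] n by (metis gr0I mod_0_imp_dvd dvd_imp_mod_0 mod_less_divisor power_0)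
qed

lemma inj_on_powers:
  assumes "has_mult_order x n"
  shows "inj_on (\<lambda>i. x ^ i) {..<n}"
proof (rule linorder_inj_onI)
  fix i j assume ij: "i < j" "i \<in> {..<n}" "j \<in> {..<n}"
  show "x ^ i \<noteq> x ^ j"
  proof
    assume eq: "x ^ i = x ^ j"
    \<comment> \<open>The factor \<open>x ^ (n - i)\<close> serves as the inverse of
      \<open>x ^ i\<close>.\<close>
    have "x ^ (j - i + n) = x ^ (n - i) * x ^ j"
      using ij by (simp add: ac_simps flip: power_add)
    also have "\<dots> = x ^ n" using ij by (simp flip: eq power_add)
    finally have "x ^ (j - i + n) = 1" using assms by (simp add: has_mult_order_def)
    then have "n dvd j - i + n" by (simp only: has_mult_order_power_eq_iff(2)[OF assms])
    then have "n dvd j - i" by simp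
    then show False using ij by (auto dest!: dvd_imp_le)
  qed
qed auto

context galois_subring
begin

lemma finite_double: "finite ((*) 2 ` K)"
  using card_double by (metis card.infinite power_not_zero zero_neq_numeral)

lemma r_pos: "r > 0"
proof (rule ccontr)
  assume "\<not> r > 0"
  then have "card ((*) 2 ` K) = 1" using card_double by simp
  moreover have "0 \<in> (*) 2 ` K" "2 \<in> (*) 2 ` K" using zero_mem one_mem by force+
  ultimately show False using two_neq_0 by (metis card_1_singletonE singletonD)
qed

lemma uminus_mem: "x \<in> K \<Longrightarrow> - x \<in> K"
proof -
  assume x: "x \<in> K"
  have "x + (x + x + x) = 4 * x" by simp
  then have "- x = x + x + x" by (simp only: four_eq_0 mult_zero_left minus_unique)
  then show ?thesis by (metis x add_mem)
qed

lemma diff_mem: "x \<in> K \<Longrightarrow> y \<in> K \<Longrightarrow> x - y \<in> K"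
  using add_mem[of x "- y"] uminus_mem by simp

lemma power_mem: "x \<in> K \<Longrightarrow> x ^ n \<in> K"
  by (induction n) (auto simp: one_mem mult_mem)

lemma mult_eq_0_if_double_eq_0:
  assumes "x \<in> K" "y \<in> K" "2 * x = 0" "2 * y = 0"
  shows "x * y = 0"
proof -
  obtain x' where "x = 2 * x'" using double_eq_0 assms by blast
  then have "x * y = x' * (2 * y)" by (simp add: algebra_simps)
  then show ?thesis using assms by simp
qed

text \<open>Squaring forgets the choice of a lift: for \<open>d = x - y\<close> with
  \<open>2 * d = 0\<close>, both \<open>2 * d * y\<close> and \<open>d * d\<close> vanish. Repeated
  squaring therefore makes a canonical lift out of a residue, which is the source of the
  Teichmueller elements.\<close>

lemma square_eq_if_double_eq:
  assumes "x \<in> K" "y \<in> K" "2 * x = 2 * y"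
  shows "x\<^sup>2 = y\<^sup>2"
proof -
  have "x - y \<in> K" "2 * (x - y) = 0" using assms diff_mem by (auto simp: algebra_simps)
  then have "(x - y) * (x - y) = 0" using mult_eq_0_if_double_eq_0 by blast
  moreover have "x\<^sup>2 = y\<^sup>2 + 2 * (x - y) * y + (x - y) * (x - y)"
    by (simp add: algebra_simps power2_eq_square)
  ultimately show ?thesis using \<open>2 * (x - y) = 0\<close> by simp
qed

lemma power_two_power_eq_if_double_eq:
  assumes "x \<in> K" "y \<in> K" "2 * x = 2 * y" "n > 0"
  shows "x ^ (2 ^ n) = y ^ (2 ^ n)"
proof -
  obtain m where "n = Suc m" using \<open>n > 0\<close> by (cases n) auto
  then show ?thesis using square_eq_if_double_eq[OF assms(1-3)] by (simp add: power_mult)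
qed

lemma eq_if_double_eq:
  assumes "x \<in> K" "y \<in> K" "2 * x = 2 * y" "x ^ (2 ^ n) = x" "y ^ (2 ^ n) = y" "n > 0"
  shows "x = y"
  using power_two_power_eq_if_double_eq[of x y n] assms by simp

text \<open>The domain property of the residues is applied twice: first it makes \<open>z\<close>
  even, \<open>z = 2 * w\<close>, and then it applies to \<open>w\<close>.\<close>

lemma nonzero_divisor:
  assumes "x \<in> K" "z \<in> K" "2 * x \<noteq> 0" "x * z = 0"
  shows "z = 0"
proof -
  have "2 * z = 0" using double_mult_eq_0[of x z] assms by simp
  then obtain w where w: "w \<in> K" "z = 2 * w" using double_eq_0 assms by blast
  then have "2 * (x * w) = 0" using assms by (simp add: algebra_simps)
  then show ?thesis using double_mult_eq_0[of x w] assms w by simp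
qed

text \<open>The residue field is realised on \<open>2K\<close>: its elements are the doubles \<open>2x\<close>, with
  \<open>2x \<otimes> 2y = 2xy\<close>.\<close>

definition half :: "'a \<Rightarrow> 'a" where
  "half a = (SOME x. x \<in> K \<and> 2 * x = a)"

definition residue_field :: "'a ring" where
  "residue_field = \<lparr>carrier = (*) 2 ` K, monoid.mult = (\<lambda>a b. half a * b), one = 2,
     ring.zero = 0, add = (+)\<rparr>"

lemma half: "a \<in> (*) 2 ` K \<Longrightarrow> half a \<in> K \<and> 2 * half a = a"
  unfolding half_def by (rule someI_ex) auto

lemma half_mult: "x \<in> K \<Longrightarrow> half (2 * x) * (2 * y) = 2 * (x * y)"
proof -
  assume "x \<in> K"
  then have "2 * half (2 * x) = 2 * x" using half by blast
  then have "(2 * half (2 * x)) * y = 2 * x * y" by simp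
  then show ?thesis by (simp add: ac_simps)
qed

lemma residue_field_mult:
  "x \<in> K \<Longrightarrow> (2 * x) \<otimes>\<^bsub>residue_field\<^esub> (2 * y) = 2 * (x * y)"
  by (simp only: residue_field_def monoid.simps half_mult)

lemma field_residue_field: "field residue_field"
proof -
  have "cring residue_field"
  proof (rule cringI)
    show "abelian_group residue_field"
    proof (rule abelian_groupI)
      fix x y assume "x \<in> carrier residue_field" "y \<in> carrier residue_field"
      then obtain a b where ab: "a \<in> K" "x = 2 * a" "b \<in> K" "y = 2 * b"
        by (auto simp: residue_field_def)
      then have sum: "x + y = 2 * (a + b)" by (simp add: distrib_left)
      have "x + y \<in> (*) 2 ` K" unfolding sum using add_mem ab by blast
      then show "x \<oplus>\<^bsub>residue_field\<^esub> y \<in> carrier residue_field"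
        by (simp add: residue_field_def)
      have minus: "- x = 2 * (- a)" using ab by simp
      have "- x \<in> (*) 2 ` K" unfolding minus using uminus_mem ab by blast
      then have "- x \<in> carrier residue_field" by (simp add: residue_field_def)
      then show "\<exists>y\<in>carrier residue_field. y \<oplus>\<^bsub>residue_field\<^esub> x = \<zero>\<^bsub>residue_field\<^esub>"
        by (intro bexI[of _ "- x"]) (auto simp: residue_field_def)
    next
      have "0 = 2 * (0 :: 'a)" by simp
      then show "\<zero>\<^bsub>residue_field\<^esub> \<in> carrier residue_field"
        using zero_mem unfolding residue_field_def by (metis image_eqI partial_object.select_convs(1) ring.select_convs(1))
    qed (simp_all add: residue_field_def ac_simps)
    show "comm_monoid residue_field"
    proof (rule comm_monoidI)
      fix x y assume "x \<in> carrier residue_field" "y \<in> carrier residue_field"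
      then obtain a b where ab: "a \<in> K" "b \<in> K" "x = 2 * a" "y = 2 * b"
        by (auto simp: residue_field_def)
      then show "x \<otimes>\<^bsub>residue_field\<^esub> y = y \<otimes>\<^bsub>residue_field\<^esub> x"
        by (simp only: residue_field_mult) (simp only: mult.commute)
      show "x \<otimes>\<^bsub>residue_field\<^esub> y \<in> carrier residue_field"
        using ab mult_mem by (simp only: residue_field_mult) (simp add: residue_field_def)
      show "\<one>\<^bsub>residue_field\<^esub> \<otimes>\<^bsub>residue_field\<^esub> x = x"
        using residue_field_mult[OF one_mem, of a] ab by (simp add: residue_field_def)
      fix z assume "z \<in> carrier residue_field"
      then obtain c where c: "z = 2 * c" by (auto simp: residue_field_def)
      show "x \<otimes>\<^bsub>residue_field\<^esub> y \<otimes>\<^bsub>residue_field\<^esub> z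
          = x \<otimes>\<^bsub>residue_field\<^esub> (y \<otimes>\<^bsub>residue_field\<^esub> z)"
        using ab c by (simp only: residue_field_mult mult_mem mult.assoc)
    next
      have "2 * 1 \<in> (*) 2 ` K" using one_mem by blast
      then show "\<one>\<^bsub>residue_field\<^esub> \<in> carrier residue_field" by (simp add: residue_field_def)
    qed
    fix x y z
    assume "x \<in> carrier residue_field" "y \<in> carrier residue_field" "z \<in> carrier residue_field"
    then obtain a b c where abc: "a \<in> K" "b \<in> K" "x = 2 * a" "y = 2 * b" "z = 2 * c"
      by (auto simp: residue_field_def)
    have add: "u \<oplus>\<^bsub>residue_field\<^esub> v = u + v" for u v by (simp add: residue_field_def)
    have "x + y = 2 * (a + b)" using abc by (simp add: distrib_left)
    then show "(x \<oplus>\<^bsub>residue_field\<^esub> y) \<otimes>\<^bsub>residue_field\<^esub> z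
             = x \<otimes>\<^bsub>residue_field\<^esub> z \<oplus>\<^bsub>residue_field\<^esub> y \<otimes>\<^bsub>residue_field\<^esub> z"
      using abc add_mem[of a b] by (simp only: add residue_field_mult) (simp add: algebra_simps)
  qed
  then interpret cring residue_field .
  show ?thesis
  proof (rule cring_fieldI2)
    show "\<zero>\<^bsub>residue_field\<^esub> \<noteq> \<one>\<^bsub>residue_field\<^esub>"
      using two_neq_0 by (simp add: residue_field_def)
    fix a assume "a \<in> carrier residue_field" "a \<noteq> \<zero>\<^bsub>residue_field\<^esub>"
    then obtain x where x: "x \<in> K" "a = 2 * x" "2 * x \<noteq> 0" by (auto simp: residue_field_def)
    \<comment> \<open>The inverse comes from finiteness: multiplication by \<open>x\<close> is
      injective on \<open>2K\<close>, hence onto, and hits the unit element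
      \<open>2 * 1\<close>.\<close>
    have "inj_on ((*) x) ((*) 2 ` K)"
    proof (rule inj_onI)
      fix b c assume "b \<in> (*) 2 ` K" "c \<in> (*) 2 ` K" and eq: "x * b = x * c"
      then have "b - c \<in> K"
        using diff_mem mult_mem add_mem one_mem by (metis imageE mult_2)
      moreover have "x * (b - c) = 0" using eq by (simp add: algebra_simps)
      ultimately show "b = c" using nonzero_divisor[of x "b - c"] x by simp
    qed
    moreover have "(*) x ` (*) 2 ` K \<subseteq> (*) 2 ` K"
      using x mult_mem by (auto simp: mult.left_commute[of x 2])
    ultimately have "(*) x ` (*) 2 ` K = (*) 2 ` K"
      using endo_inj_surj[OF finite_double] by blast
    moreover have "2 * 1 \<in> (*) 2 ` K" using one_mem by blast
    ultimately obtain c where "c \<in> (*) 2 ` K" "x * c = 2 * 1" by (metis imageE)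
    then show "\<exists>b\<in>carrier residue_field. a \<otimes>\<^bsub>residue_field\<^esub> b = \<one>\<^bsub>residue_field\<^esub>"
      using x half_mult by (intro bexI[of _ c]) (auto simp: residue_field_def mult.left_commute)
  qed
qed

lemma residue_field_pow:
  assumes "x \<in> K"
  shows "(2 * x) [^]\<^bsub>residue_field\<^esub> (n :: nat) = 2 * x ^ n"
proof (induction n)
  case 0
  show ?case by (simp add: nat_pow_def residue_field_def)
next
  case (Suc n)
  then show ?case
    using half_mult[OF power_mem[OF assms], of n x] 
    by (simp add: nat_pow_def) (simp add: residue_field_def ac_simps)
qed

text \<open>The multiplicative group of the finite residue field is cyclic of order
  \<open>2 ^ r - 1\<close>. Read back in \<open>K\<close>, its equations hold only after
  doubling.\<close>

lemma ex_residue_generator: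
  obtains x where "x \<in> K" "2 * x ^ (2 ^ r - 1) = 2"
    and "\<And>y. y \<in> K \<Longrightarrow> 2 * y \<noteq> 0 \<Longrightarrow> \<exists>i. 2 * y = 2 * x ^ i"
proof -
  interpret Ring.field residue_field by (rule field_residue_field)
  have fin: "finite (carrier residue_field)" using finite_double by (simp add: residue_field_def)
  obtain a where a: "a \<in> carrier (mult_of residue_field)"
    and gen: "carrier (mult_of residue_field) = {a [^]\<^bsub>residue_field\<^esub> i |i::nat. i \<in> UNIV}"
    using finite_field_mult_group_has_gen[OF fin] by (auto simp: nat_pow_mult_of)
  then obtain x where x: "x \<in> K" "a = 2 * x" by (auto simp: residue_field_def)
  have "Coset.order (mult_of residue_field) = 2 ^ r - 1"
    using order_mult_of[OF fin] by (simp add: Coset.order_def residue_field_def card_double)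
  then have "a [^]\<^bsub>residue_field\<^esub> ((2 :: nat) ^ r - 1) = \<one>\<^bsub>residue_field\<^esub>"
    using group.pow_order_eq_1[OF field_mult_group a] by (simp add: nat_pow_mult_of)
  then have "2 * x ^ (2 ^ r - 1) = 2"
    unfolding x(2) residue_field_pow[OF x(1)] by (simp add: residue_field_def)
  moreover have "\<exists>i. 2 * y = 2 * x ^ i" if "y \<in> K" "2 * y \<noteq> 0" for y
  proof -
    have "2 * y \<in> carrier (mult_of residue_field)"
      using that by (simp add: residue_field_def)
    then show ?thesis unfolding gen x(2) using residue_field_pow[OF x(1)] by auto
  qed
  ultimately show thesis using that x by blast
qed

text \<open>A residue generator \<open>x\<close> satisfies \<open>x ^ N = 1\<close> only modulo 2.
  Its power \<open>x ^ (2 ^ r)\<close> has the same residue, because \<open>2 ^ r = N + 1\<close>,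
  and is an exact root of unity: its \<open>N\<close>-th power is the \<open>2 ^ r\<close>-th power
  of an element that is 1 modulo 2.\<close>

lemma ex_mult_order: "\<exists>x. x \<in> K \<and> has_mult_order x (2 ^ r - 1)"
proof -
  define N where "N = (2 :: nat) ^ r - 1"
  have N: "2 ^ r = N + 1" "N > 0" using r_pos one_less_power[of "2 :: nat" r] by (auto simp: N_def)
  obtain x where x: "x \<in> K" "2 * x ^ N = 2"
    and gen: "\<And>y. y \<in> K \<Longrightarrow> 2 * y \<noteq> 0 \<Longrightarrow> \<exists>i. 2 * y = 2 * x ^ i"
    using ex_residue_generator unfolding N_def by blast
  define \<xi> where "\<xi> = x ^ (2 ^ r)"
  have "2 * \<xi> = 2 * x ^ N * x" by (simp add: \<xi>_def N ac_simps)
  then have \<xi>: "\<xi> \<in> K" "2 * \<xi> = 2 * x" using x power_mem by (auto simp: \<xi>_def)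
  have double_\<xi>: "2 * \<xi> ^ m = 2 * x ^ m" for m
  proof (induction m)
    case (Suc m)
    have "2 * \<xi> ^ Suc m = \<xi> * (2 * \<xi> ^ m)" by (simp add: ac_simps)
    also have "\<dots> = \<xi> * (2 * x ^ m)" by (simp only: Suc)
    also have "\<dots> = (2 * \<xi>) * x ^ m" by (simp only: ac_simps)
    also have "\<dots> = (2 * x) * x ^ m" by (simp only: \<xi>(2))
    also have "\<dots> = 2 * x ^ Suc m" by (simp only: power_Suc ac_simps)
    finally show ?case .
  qed simp
  have "\<xi> ^ N = (x ^ N) ^ (2 ^ r)" by (simp add: \<xi>_def mult.commute flip: power_mult)
  also have "\<dots> = 1"
    using power_two_power_eq_if_double_eq[of "x ^ N" 1 r] x power_mem one_mem r_pos by simp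
  finally have \<xi>_N: "\<xi> ^ N = 1" .
  \<comment> \<open>Together with 0 the powers of \<open>\<xi>\<close> meet every residue, but an
    order \<open>m < N\<close> leaves at most \<open>m + 1 < 2 ^ r\<close> of them.\<close>
  have False if m: "0 < m" "m < N" "\<xi> ^ m = 1" for m
  proof -
    have "(*) 2 ` K \<subseteq> insert 0 ((\<lambda>i. 2 * \<xi> ^ i) ` {..<m})"
    proof
      fix a assume "a \<in> (*) 2 ` K"
      then obtain y where y: "y \<in> K" "a = 2 * y" by blast
      show "a \<in> insert 0 ((\<lambda>i. 2 * \<xi> ^ i) ` {..<m})"
      proof (cases "a = 0")
        case False
        then obtain i where "a = 2 * \<xi> ^ i" using gen y by (auto simp: double_\<xi>)
        also have "\<xi> ^ i = \<xi> ^ (m * (i div m) + i mod m)" by simp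
        also have "\<dots> = \<xi> ^ (i mod m)" by (simp only: power_add power_mult m power_one mult_1)
        finally show ?thesis using m by auto
      qed simp
    qed
    then have "card ((*) 2 ` K) \<le> card (insert 0 ((\<lambda>i. 2 * \<xi> ^ i) ` {..<m}))"
      by (intro card_mono) auto
    also have "\<dots> \<le> m + 1"
      using card_image_le[of "{..<m}" "\<lambda>i. 2 * \<xi> ^ i"] by (simp add: card_insert_if)
    finally show False using m N by (simp add: card_double)
  qed
  then have "has_mult_order \<xi> N" using \<xi>_N N by (auto simp: has_mult_order_def)
  then show ?thesis using \<xi> N_def by blast
qed

section \<open>Teichmueller set, Frobenius map and trace\<close>

lemma teichmueller_obtain:
  obtains \<xi> where "\<xi> \<in> K" "has_mult_order \<xi> (2 ^ r - 1)"
    and "teichmueller K r = insert 0 ((\<lambda>i. \<xi> ^ i) ` {..<2 ^ r - 1})"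
proof -
  define \<xi> where "\<xi> = (SOME x. x \<in> K \<and> has_mult_order x (2 ^ r - 1))"
  have "\<xi> \<in> K \<and> has_mult_order \<xi> (2 ^ r - 1)"
    unfolding \<xi>_def by (rule someI_ex) (rule ex_mult_order)
  moreover have "teichmueller K r = insert 0 ((\<lambda>i. \<xi> ^ i) ` {..<2 ^ r - 1})"
    by (auto simp: teichmueller_def Let_def \<xi>_def)
  ultimately show thesis using that by blast
qed

lemma teichmueller_props:
  shows teichmueller_imp: "x \<in> teichmueller K r \<Longrightarrow> x \<in> K \<and> x ^ (2 ^ r) = x"
    and card_teichmueller: "card (teichmueller K r) = 2 ^ r"
proof -
  obtain \<xi> where \<xi>: "\<xi> \<in> K" "has_mult_order \<xi> (2 ^ r - 1)"
    and T: "teichmueller K r = insert 0 ((\<lambda>i. \<xi> ^ i) ` {..<2 ^ r - 1})"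
    by (rule teichmueller_obtain)
  have nz: "\<xi> ^ i \<noteq> 0" for i
  proof
    assume "\<xi> ^ i = 0"
    then have "(\<xi> ^ i) ^ (2 ^ r - 1) = 0"
      using \<xi>(2) by (simp add: power_0_left has_mult_order_def)
    moreover have "(\<xi> ^ i) ^ (2 ^ r - 1) = (\<xi> ^ (2 ^ r - 1)) ^ i"
      by (simp add: mult.commute flip: power_mult)
    ultimately have "(0 :: 'a) = 1" using \<xi>(2) by (simp add: has_mult_order_def)
    then show False using two_neq_0 by (metis mult_zero_right mult_1_right)
  qed
  show "x \<in> K \<and> x ^ (2 ^ r) = x" if x: "x \<in> teichmueller K r"
  proof (cases "x = 0")
    case False
    then obtain i where i: "x = \<xi> ^ i" using x T by auto
    have "x ^ (2 ^ r - 1) = (\<xi> ^ (2 ^ r - 1)) ^ i"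
      by (simp add: i mult.commute flip: power_mult)
    then have "x ^ (2 ^ r - 1) * x = x" using \<xi>(2) by (simp add: has_mult_order_def)
    then have "x ^ (2 ^ r) = x" using power_minus_mult[of "2 ^ r" x] by simp
    then show ?thesis using i \<xi>(1) power_mem by simp
  qed (simp add: zero_mem power_0_left)
  have "0 \<notin> (\<lambda>i. \<xi> ^ i) ` {..<2 ^ r - 1}" using nz by (metis imageE)
  then show "card (teichmueller K r) = 2 ^ r"
    using inj_on_powers[OF \<xi>(2)] by (simp add: T card_insert_if card_image)
qed

text \<open>The \<open>2 ^ r\<close> Teichmueller elements have distinct residues, so they cover all
  of them; a root of X^(2^r) - X shares its residue with one of them and is then equal to it. This
  frees the set from the choice of \<open>\<xi>\<close>.\<close>

lemma teichmueller_iff: "x \<in> teichmueller K r \<longleftrightarrow> x \<in> K \<and> x ^ (2 ^ r) = x"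
proof -
  have "inj_on ((*) 2) (teichmueller K r)"
  proof (rule inj_onI)
    fix x y assume "x \<in> teichmueller K r" "y \<in> teichmueller K r" "2 * x = 2 * y"
    then show "x = y" using eq_if_double_eq[of x y r] teichmueller_imp r_pos by blast
  qed
  then have "card ((*) 2 ` teichmueller K r) = card ((*) 2 ` K)"
    by (simp add: card_image card_teichmueller card_double)
  moreover have "(*) 2 ` teichmueller K r \<subseteq> (*) 2 ` K" using teichmueller_imp by auto
  ultimately have onto: "(*) 2 ` teichmueller K r = (*) 2 ` K"
    by (intro card_subset_eq finite_double)
  show ?thesis
  proof
    assume x: "x \<in> K \<and> x ^ (2 ^ r) = x"
    then have "2 * x \<in> (*) 2 ` teichmueller K r" using onto by blast
    then obtain t where t: "t \<in> teichmueller K r" "2 * x = 2 * t" by blast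
    then have "x = t" using eq_if_double_eq[of x t r] teichmueller_imp x r_pos by blast
    with t show "x \<in> teichmueller K r" by simp
  qed (use teichmueller_imp in blast)
qed

lemma frob_teichmueller:
  assumes "x \<in> K" "x ^ (2 ^ r) = x"
  shows "frob K r s x = x ^ (2 ^ s)"
proof -
  have x: "x \<in> teichmueller K r" and zero: "0 \<in> teichmueller K r"
    using assms zero_mem by (auto simp: teichmueller_iff power_0_left)
  have "(THE (a1, a2). a1 \<in> teichmueller K r \<and> a2 \<in> teichmueller K r \<and> x = a1 + 2 * a2) = (x, 0)"
  proof (rule the_equality)
    fix c
    assume "case c of (a1, a2) \<Rightarrow> a1 \<in> teichmueller K r \<and> a2 \<in> teichmueller K r \<and> x = a1 + 2 * a2"
    then obtain a1 a2 where c: "c = (a1, a2)" "a1 \<in> teichmueller K r" "a2 \<in> teichmueller K r"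
      "x = a1 + 2 * a2" by (cases c) auto
    \<comment> \<open>Doubling removes \<open>a2\<close> and leaves the residue of
      \<open>a1\<close>, which determines \<open>a1\<close>; then \<open>2 * a2 = 0\<close>
      determines \<open>a2\<close> in the same way.\<close>
    have "2 * x = 2 * a1 + 4 * a2" by (simp add: c algebra_simps)
    then have "x = a1"
      using eq_if_double_eq[of x a1 r] x c r_pos by (auto simp: four_eq_0 teichmueller_iff)
    moreover from this have "a2 = 0"
      using eq_if_double_eq[of a2 0 r] zero c r_pos by (auto simp: teichmueller_iff)
    ultimately show "c = (x, 0)" using c by simp
  qed (use x zero in auto)
  then show ?thesis by (simp add: frob_def power_0_left)
qed

text \<open>Powers of a Teichmueller element are again Teichmueller, so the Frobenius map remains a
  plain power under iteration. The exponent is kept as \<open>(2 ^ s) ^ k\<close>, the shape of a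
  coset of the group generated by \<open>2 ^ s\<close>.\<close>

lemma TR_teichmueller:
  assumes x: "x \<in> K" "x ^ (2 ^ r) = x"
  shows "TR K s r x = (\<Sum>k<r div s. x ^ ((2 ^ s) ^ k))"
proof -
  have "(frob K r s ^^ k) x = x ^ ((2 ^ s) ^ k)" for k
  proof (induction k)
    case (Suc k)
    have "(x ^ ((2 ^ s) ^ k)) ^ (2 ^ r) = (x ^ (2 ^ r)) ^ ((2 ^ s) ^ k)"
      by (simp add: mult.commute flip: power_mult)
    then have "(x ^ ((2 ^ s) ^ k)) ^ (2 ^ r) = x ^ ((2 ^ s) ^ k)" by (simp add: x)
    then show ?case
      using frob_teichmueller[OF power_mem[OF x(1)]] by (simp add: Suc mult.commute flip: power_mult)
  qed simp
  then show ?thesis by (simp add: TR_def)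
qed

end

text \<open>The roots of \<open>X ^ (2 ^ s) - X\<close> in the ambient ring are exhausted by the
  Teichmueller set of \<open>K\<close>.\<close>

lemma fixed_by_power_mem_subring:
  fixes K :: "'a::comm_ring_1 set"
  assumes "galois_subring (UNIV :: 'a set) r" and "galois_subring K s" and "s dvd r"
    and "x ^ (2 ^ s) = x"
  shows "x \<in> K"
proof -
  interpret U: galois_subring "UNIV :: 'a set" r by fact
  interpret K: galois_subring K s by fact
  define n where "n = (2 :: nat) ^ s - 1"
  define N where "N = (2 :: nat) ^ r - 1"
  have s: "2 ^ s = n + 1" "n > 0" using K.r_pos one_less_power[of "2 :: nat" s] by (auto simp: n_def)
  have N: "2 ^ r = N + 1" "N > 0" using U.r_pos one_less_power[of "2 :: nat" r] by (auto simp: N_def)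
  have "n dvd N"
  proof -
    obtain t where "r = s * t" using \<open>s dvd r\<close> by blast
    moreover have "[n + 1 = 0 + 1] (mod n)" by (simp only: cong_add_rcancel_nat) (simp add: cong_def)
    then have "[(n + 1) ^ t = (0 + 1) ^ t] (mod n)" by (rule cong_pow)
    ultimately have "[2 ^ r = 1] (mod n)" by (simp only: power_mult s add_0 power_one)
    then have "[N + 1 = 0 + 1] (mod n)" using N by simp
    then show ?thesis by (simp only: cong_add_rcancel_nat cong_0_iff)
  qed
  obtain \<xi> :: 'a where "\<xi> \<in> UNIV" and \<xi>: "has_mult_order \<xi> N"
    and T: "teichmueller UNIV r = insert 0 ((\<lambda>i. \<xi> ^ i) ` {..<N})"
    by (rule U.teichmueller_obtain[folded N_def])
  define S where "S = {y :: 'a. y ^ (2 ^ s) = y}"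
  \<comment> \<open>A nonzero root is \<open>\<xi> ^ i\<close> with \<open>N\<close> dividing
    \<open>i * n\<close>, so \<open>i\<close> is one of the \<open>n\<close> multiples of
    \<open>N div n\<close> below \<open>N\<close>. Hence \<open>S\<close> has at most
    \<open>2 ^ s\<close> elements, as many as the Teichmueller set of \<open>K\<close>, which it
    contains.\<close>
  have S_sub: "S \<subseteq> insert 0 ((\<lambda>k. \<xi> ^ (N div n * k)) ` {..<n})"
  proof
    fix y assume "y \<in> S"
    then have y: "y ^ (2 ^ s) = y" by (simp add: S_def)
    have y_pow: "y ^ (2 ^ (s * t)) = y" for t
      by (induction t) (simp_all add: power_add power_mult y)
    have "y \<in> teichmueller UNIV r"
      using y_pow \<open>s dvd r\<close> by (auto simp: U.teichmueller_iff)
    show "y \<in> insert 0 ((\<lambda>k. \<xi> ^ (N div n * k)) ` {..<n})"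
    proof (cases "y = 0")
      case False
      then obtain i where i: "i < N" "y = \<xi> ^ i" using \<open>y \<in> teichmueller UNIV r\<close> T by auto
      have "y ^ (2 ^ s) * \<xi> ^ (N - i) = y * \<xi> ^ (N - i)" by (simp add: y)
      moreover have "y ^ (2 ^ s) * \<xi> ^ (N - i) = \<xi> ^ (i * n + N)"
        using i by (simp add: s algebra_simps flip: power_mult power_add)
      moreover have "y * \<xi> ^ (N - i) = 1"
        using i \<xi> by (simp add: has_mult_order_def flip: power_add)
      ultimately have "N dvd i * n + N" using has_mult_order_power_eq_iff(2)[OF \<xi>] by simp
      then have "N dvd i * n" by simp
      then have "N div n dvd i" using \<open>n dvd N\<close> s(2) by (simp add: div_dvd_iff_mult)
      then obtain k where k: "i = N div n * k" by blast
      have "k < n"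
      proof (rule ccontr)
        assume "\<not> k < n"
        then have "N div n * n \<le> i" using k by simp
        then show False using i \<open>n dvd N\<close> by simp
      qed
      then show ?thesis using i k by blast
    qed simp
  qed
  have fin: "finite S" using S_sub by (rule finite_subset) simp
  have "card S \<le> card (insert 0 ((\<lambda>k. \<xi> ^ (N div n * k)) ` {..<n}))"
    using S_sub by (intro card_mono) auto
  also have "\<dots> \<le> 2 ^ s"
    using card_image_le[of "{..<n}" "\<lambda>k. \<xi> ^ (N div n * k)"] by (simp add: card_insert_if s)
  finally have card_S: "card S \<le> 2 ^ s" .
  have T_sub: "teichmueller K s \<subseteq> S" by (auto simp: K.teichmueller_iff S_def)
  have "teichmueller K s = S"
    using T_sub fin card_S K.card_teichmueller by (intro card_seteq) simp_all
  then show ?thesis using assms(4) by (auto simp: K.teichmueller_iff S_def)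
qed

subsection \<open>Powers of a root of unity\<close>

lemma power_cong:
  assumes "has_mult_order x n" and "[a = b] (mod n)"
  shows "x ^ a = x ^ b"
  using has_mult_order_power_eq_iff(1)[OF assms(1)] assms(2) by (metis cong_def)

text \<open>Exponents built from \<open>g\<close> and \<open>h\<close> may be negative; the inverse
  is then \<open>x ^ (n - 1)\<close>, and the exponent matters only modulo \<open>n\<close>.\<close>

lemma unit_powi_eq_power:
  assumes x: "has_mult_order x n" and k: "[k = int m] (mod int n)"
  shows "unit_powi x k = x ^ m"
proof (cases "0 \<le> k")
  case True
  then have "[nat k = m] (mod n)" using k cong_int_iff[of "nat k" m n] by simp
  then show ?thesis using True power_cong[OF x] by (simp add: unit_powi_def)
next
  case False
  have n: "n > 0" "x ^ n = 1" using x by (auto simp: has_mult_order_def)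
  then have inv: "x * x ^ (n - 1) = 1" by (simp flip: power_Suc)
  have "(THE y. x * y = 1) = x ^ (n - 1)"
  proof (rule the_equality)
    fix y assume "x * y = 1"
    have "y = (x * x ^ (n - 1)) * y" by (simp only: inv mult_1)
    also have "\<dots> = x ^ (n - 1) * (x * y)" by (simp add: ac_simps)
    finally show "y = x ^ (n - 1)" using \<open>x * y = 1\<close> by simp
  qed (rule inv)
  then have "unit_powi x k = x ^ ((n - 1) * nat (- k))"
    using False by (simp add: unit_powi_def power_mult)
  moreover have "[(n - 1) * nat (- k) = m] (mod n)"
  proof -
    have "int ((n - 1) * nat (- k)) - k = int n * (- k)"
      using False n by (simp add: of_nat_diff algebra_simps)
    then have "[int ((n - 1) * nat (- k)) = k] (mod int n)"
      by (simp only: cong_iff_dvd_diff dvd_triv_left)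
    then have "[int ((n - 1) * nat (- k)) = int m] (mod int n)" using k by (rule cong_trans)
    then show ?thesis by (simp only: cong_int_iff)
  qed
  ultimately show ?thesis using power_cong[OF x] by simp
qed

context galois_subring
begin

lemma sum_mem: "(\<And>i. i \<in> A \<Longrightarrow> f i \<in> K) \<Longrightarrow> sum f A \<in> K"
  by (induction A rule: infinite_finite_induct) (auto simp: zero_mem add_mem)

text \<open>The factor \<open>1 - x\<close> of the geometric sum can be cancelled only if it is
  nonzero modulo 2. If it were zero there, squaring would give \<open>x\<^sup>2 = 1\<close>, and an
  odd \<open>n\<close> would force \<open>x = x ^ n = 1\<close>.\<close>

lemma sum_powers_root_of_unity:
  assumes "x \<in> K" "odd n" "x ^ n = 1" "x \<noteq> 1"
  shows "(\<Sum>i<n. x ^ i) = 0"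
proof (rule nonzero_divisor)
  show "1 - x \<in> K" "(\<Sum>i<n. x ^ i) \<in> K"
    using assms by (auto intro: sum_mem power_mem diff_mem one_mem)
  show "(1 - x) * (\<Sum>i<n. x ^ i) = 0"
    using one_diff_power_eq[of x n] assms by simp
  show "2 * (1 - x) \<noteq> 0"
  proof
    assume "2 * (1 - x) = 0"
    then have "x\<^sup>2 = 1\<^sup>2" using assms one_mem
      by (intro square_eq_if_double_eq) (simp_all add: algebra_simps)
    moreover obtain k where "n = 2 * k + 1" using \<open>odd n\<close> by (rule oddE)
    ultimately have "x ^ n = x" by (simp add: power_mult)
    then show False using assms by simp
  qed
qed

lemma sum_nonzero_powers_root_of_unity:
  assumes "x \<in> K" "odd n" "x ^ n = 1" "x \<noteq> 1"
  shows "(\<Sum>i\<in>{0<..<n}. x ^ i) = - 1"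
proof -
  have "{..<n} = insert 0 {0<..<n}" using \<open>odd n\<close> by (auto intro: gr0I)
  then have "1 + (\<Sum>i\<in>{0<..<n}. x ^ i) = 0"
    using sum_powers_root_of_unity[OF assms] by simp
  then show ?thesis by (simp add: eq_neg_iff_add_eq_0 add.commute)
qed

end

subsection \<open>Sums over cyclic groups of residues\<close>

lemma sum_lessThan_mult:
  fixes F :: "nat \<Rightarrow> 'a::comm_semiring_1"
  assumes "\<And>s. F (s + n) = F s"
  shows "(\<Sum>s<m * n. F s) = of_nat m * (\<Sum>s<n. F s)"
proof -
  have F: "F (s + k * n) = F s" for s k
    by (induction k) (simp_all add: assms flip: add.assoc add: add.commute[of n])
  have "(\<Sum>s<m * n. F s) = (\<Sum>k<m. sum F {k * n..<k * n + n})"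
    by (rule sum.nat_group[symmetric])
  moreover have "sum F {k * n..<k * n + n} = (\<Sum>s<n. F s)" for k
    using sum.shift_bounds_nat_ivl[of F 0 "k * n" n] by (simp add: F add.commute atLeast0LessThan)
  ultimately show ?thesis by simp
qed

text \<open>Multiplication by a power of \<open>g\<close> only rotates the exponents modulo the
  order of \<open>g\<close>.\<close>

lemma sum_powers_mult_generator:
  fixes F :: "nat \<Rightarrow> 'a::comm_monoid_add"
  assumes F: "\<And>x y. [x = y] (mod n) \<Longrightarrow> F x = F y"
    and g: "coprime n g" and b: "[b = g ^ m] (mod n)"
  shows "(\<Sum>s<ord n g. F (b * g ^ s)) = (\<Sum>s<ord n g. F (g ^ s))"
proof -
  let ?E = "ord n g"
  have E: "?E > 0" using g by simp
  have inj: "inj_on (\<lambda>s. (m + s) mod ?E) {..<?E}"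
  proof (rule inj_onI)
    fix s t assume "s \<in> {..<?E}" "t \<in> {..<?E}" "(m + s) mod ?E = (m + t) mod ?E"
    then show "s = t" by (metis cong_add_lcancel_nat cong_def cong_less_modulus_unique_nat lessThan_iff)
  qed
  moreover have "(\<lambda>s. (m + s) mod ?E) ` {..<?E} \<subseteq> {..<?E}" using E by auto
  ultimately have "bij_betw (\<lambda>s. (m + s) mod ?E) {..<?E} {..<?E}"
    using endo_inj_surj[of "{..<?E}"] by (simp add: bij_betw_def)
  then have "(\<Sum>s<?E. F (g ^ s)) = (\<Sum>s<?E. F (g ^ ((m + s) mod ?E)))"
    by (rule sum.reindex_bij_betw[symmetric])
  moreover have "F (g ^ ((m + s) mod ?E)) = F (b * g ^ s)" for s
  proof (rule F)
    have "[g ^ ((m + s) mod ?E) = g ^ (m + s)] (mod n)"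
      using order_divides_expdiff[OF g] by (simp add: cong_def)
    also have "[g ^ (m + s) = b * g ^ s] (mod n)"
      unfolding power_add using b by (intro cong_mult cong_refl) (rule cong_sym)
    finally show "[g ^ ((m + s) mod ?E) = b * g ^ s] (mod n)" .
  qed
  ultimately show ?thesis by simp
qed

text \<open>The \<open>g ^ i\<close> with \<open>i < ord n g div ord n b\<close> represent the cosets of \<open>\<langle>b\<rangle>\<close>
  in \<open>\<langle>g\<rangle>\<close>.\<close>

lemma sum_cosets:
  fixes F :: "nat \<Rightarrow> 'a::comm_monoid_add"
  assumes F: "\<And>x y. [x = y] (mod n) \<Longrightarrow> F x = F y"
    and g: "coprime n g" and b: "[b = g ^ m] (mod n)"
  shows "(\<Sum>i<ord n g div ord n b. \<Sum>k<ord n b. F (g ^ i * b ^ k)) = (\<Sum>s<ord n g. F (g ^ s))"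
proof -
  let ?E = "ord n g" and ?d = "ord n b" and ?c = "gcd m (ord n g)"
  let ?f = "\<lambda>(i, k). (i + m * k) mod ?E"
  have E: "?E > 0" using g by simp
  have d: "?d = ?E div ?c" using ord_power[OF g, of m] ord_cong[OF b] by simp
  have c: "?c > 0" "?c dvd ?E" using E by auto
  have E_div: "?E div ?d = ?c" using d c E by (metis div_div_eq_right div_self less_numeral_extra(3) mult_1 gcd_dvd2 nonzero_mult_div_cancel_left dvd_mult_div_cancel dvd_div_eq_0_iff mult.commute)
  have cop_b: "coprime n b"
    using g cong_imp_coprime[OF cong_sym[OF b]] by (simp add: coprime_commute)
  have eq: "[g ^ ((i + m * k) mod ?E) = g ^ i * b ^ k] (mod n)" for i k
  proof -
    have "[g ^ ((i + m * k) mod ?E) = g ^ (i + m * k)] (mod n)"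
      using order_divides_expdiff[OF g] by (simp add: cong_def)
    also have "[g ^ (i + m * k) = g ^ i * b ^ k] (mod n)"
      unfolding power_add power_mult
      by (intro cong_mult cong_refl cong_pow) (rule cong_sym[OF b])
    finally show ?thesis .
  qed
  \<comment> \<open>Since \<open>?c\<close> divides both \<open>m\<close> and \<open>?E\<close>, the
    exponent determines \<open>i\<close> modulo \<open>?c\<close>; what remains determines
    \<open>b ^ k\<close>, hence \<open>k\<close>. Surjectivity is then a matter of counting.\<close>
  have inj: "inj_on ?f ({..<?c} \<times> {..<?d})"
  proof (rule inj_onI, clarsimp)
    fix i k i' k'
    assume i: "i < ?c" "i' < ?c" and k: "k < ?d" "k' < ?d"
      and eq': "(i + m * k) mod ?E = (i' + m * k') mod ?E"
    have "[i + m * k = i' + m * k'] (mod ?c)"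
      using eq' c(2) by (metis cong_def cong_dvd_modulus_nat)
    moreover have "[i + m * k = i] (mod ?c)" "[i' + m * k' = i'] (mod ?c)"
      by (simp_all add: cong_def mod_add_eq[symmetric, of _ "m * _"] mod_eq_0_iff_dvd[THEN iffD2])
    ultimately have "[i = i'] (mod ?c)" by (metis cong_trans cong_sym)
    then have "i = i'" using i by (metis cong_less_modulus_unique_nat)
    then have "[m * k = m * k'] (mod ?E)" using eq' by (simp flip: cong_def add: cong_add_lcancel_nat)
    then have "[g ^ (m * k) = g ^ (m * k')] (mod n)" using order_divides_expdiff[OF g] by simp
    then have "[b ^ k = b ^ k'] (mod n)"
      unfolding power_mult by (meson b cong_pow cong_sym cong_trans)
    then have "[k = k'] (mod ?d)" using order_divides_expdiff[OF cop_b] by simp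
    then have "k = k'" using k by (metis cong_less_modulus_unique_nat)
    with \<open>i = i'\<close> show "i = i' \<and> k = k'" by simp
  qed
  have "card ({..<?c} \<times> {..<?d}) = card {..<?E}" using c by (simp add: d)
  moreover have "?f ` ({..<?c} \<times> {..<?d}) \<subseteq> {..<?E}" using E by auto
  ultimately have "bij_betw ?f ({..<?c} \<times> {..<?d}) {..<?E}"
    unfolding bij_betw_def using inj by (metis card_image card_subset_eq finite_lessThan)
  then have "(\<Sum>s<?E. F (g ^ s)) = (\<Sum>x\<in>{..<?c} \<times> {..<?d}. F (g ^ ?f x))"
    by (rule sum.reindex_bij_betw[symmetric])
  also have "\<dots> = (\<Sum>(i, k)\<in>{..<?c} \<times> {..<?d}. F (g ^ i * b ^ k))"
    using F[OF eq] by (intro sum.cong) auto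
  also have "\<dots> = (\<Sum>i<?c. \<Sum>k<?d. F (g ^ i * b ^ k))"
    by (rule sum.cartesian_product[symmetric])
  finally show ?thesis unfolding E_div by simp
qed

lemma sum_primroot_powers:
  fixes F :: "nat \<Rightarrow> 'a::comm_monoid_add"
  assumes F: "\<And>x y. [x = y] (mod p) \<Longrightarrow> F x = F y"
    and p: "prime p" and g: "residue_primroot p g"
  shows "(\<Sum>s<p - 1. F (g ^ s)) = (\<Sum>x\<in>{0<..<p}. F x)"
proof -
  have "bij_betw (\<lambda>i. g ^ i mod p) {..<p - 1} {0<..<p}"
    using residue_primroot_is_generator[OF prime_gt_1_nat[OF p] g] p
    by (simp add: totient_prime totatives_prime)
  then have "(\<Sum>x\<in>{0<..<p}. F x) = (\<Sum>s<p - 1. F (g ^ s mod p))"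
    by (rule sum.reindex_bij_betw[symmetric])
  moreover have "F (g ^ s mod p) = F (g ^ s)" for s by (rule F) simp
  ultimately show ?thesis by simp
qed

text \<open>If \<open>i\<^sup>2 = -1\<close>, then \<open>(i + 1)\<^sup>2 = 2 i\<close>; so \<open>2 ^ ((p - 1) div 2) = 1\<close> would give
  \<open>i ^ ((p - 1) div 2) = 1\<close>, while this power is \<open>-1\<close>.\<close>

lemma four_dvd_ord_2:
  assumes p: "prime p" and mod8: "[p = 5] (mod 8)" and g: "residue_primroot p g"
  shows "4 dvd ord p 2"
proof (rule ccontr)
  assume n4: "\<not> 4 dvd ord p 2"
  have "p mod 8 = 5" using mod8 by (simp add: cong_def)
  define k where "k = p div 8"
  have p_eq: "p = 8 * k + 5" using div_mult_mod_eq[of p 8] \<open>p mod 8 = 5\<close> by (simp add: k_def)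
  have p2: "p > 2" using p_eq by simp
  have cop2: "coprime p 2" using p_eq by simp
  define m where "m = 4 * k + 2"
  have p1: "p - 1 = 2 * m" by (simp add: p_eq m_def)
  have ord_dvd: "ord p 2 dvd 2 * m"
    using order_divides_totient[OF cop2] p p1 by (simp add: totient_prime)
  \<comment> \<open>As 4 divides \<open>2 * m\<close>, an order not divisible by 4 has an even
    cofactor in \<open>2 * m\<close>.\<close>
  have "ord p 2 dvd m"
  proof -
    obtain c where c: "2 * m = ord p 2 * c" using ord_dvd by blast
    have "even c"
    proof (rule ccontr)
      assume "odd c"
      then have "coprime 4 c" by (metis coprime_left_2_iff_odd coprime_mult_left_iff numeral_Bit0 mult_2 mult_numeral_1_right num_double numeral_times_numeral)
      moreover have "2 * m = 4 * (2 * k + 1)" by (simp add: m_def)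
      then have "4 dvd ord p 2 * c" unfolding c by (simp only: dvd_triv_left)
      ultimately show False using n4 coprime_dvd_mult_left_iff by blast
    qed
    then obtain c' where "c = 2 * c'" by blast
    with c show ?thesis by simp
  qed
  then have two_m: "[2 ^ m = 1] (mod p)" by (simp only: ord_divides)
  have ord_g: "ord p g = p - 1" "coprime p g"
    using g p by (auto simp: residue_primroot_def totient_prime)
  \<comment> \<open>Here \<open>2 * k + 1\<close> is \<open>(p - 1) div 4\<close>, so
    \<open>i\<close> is a primitive fourth root of unity modulo \<open>p\<close>. That this exponent
    is odd gives \<open>i ^ m = (i ^ 2) ^ (2 * k + 1) = -1\<close>.\<close>
  define i where "i = g ^ (2 * k + 1)"
  have dvd: "int p dvd int i ^ 2 + 1"
  proof -
    have "(2 * k + 1) * 4 = p - 1" by (simp add: p_eq)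
    then have "[i ^ 4 = 1] (mod p)"
      by (simp only: i_def ord_divides ord_g dvd_refl flip: power_mult)
    then have "[int i ^ 4 = 1] (mod int p)" by (metis cong_int_iff of_nat_1 of_nat_power)
    then have "int p dvd int i ^ 4 - 1" by (simp only: cong_iff_dvd_diff)
    also have "int i ^ 4 - 1 = (int i ^ 2 - 1) * (int i ^ 2 + 1)"
      by (simp add: algebra_simps power4_eq_xxxx power2_eq_square)
    finally have "int p dvd int i ^ 2 - 1 \<or> int p dvd int i ^ 2 + 1"
      using p by (simp add: prime_dvd_mult_iff)
    moreover have "\<not> int p dvd int i ^ 2 - 1"
    proof
      assume "int p dvd int i ^ 2 - 1"
      then have "[int (i ^ 2) = int 1] (mod int p)" by (simp add: cong_iff_dvd_diff)
      then have "[g ^ (2 * (2 * k + 1)) = 1] (mod p)"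
        by (simp only: cong_int_iff i_def mult.commute flip: power_mult)
      then have "p - 1 dvd 2 * (2 * k + 1)" by (simp only: ord_divides ord_g)
      then have "p - 1 \<le> 2 * (2 * k + 1)" by (rule dvd_imp_le) simp
      then show False by (simp add: p_eq)
    qed
    ultimately show ?thesis by simp
  qed
  then have i2: "[int i ^ 2 = - 1] (mod int p)" by (simp add: cong_iff_dvd_diff)
  have not_dvd: "\<not> int p dvd int i + 1"
  proof
    assume "int p dvd int i + 1"
    then have "int p dvd (int i + 1) * (int i - 1)" by simp
    then have "[int i ^ 2 = 1] (mod int p)"
      by (simp add: cong_iff_dvd_diff algebra_simps power2_eq_square)
    then have "[- 1 = 1] (mod int p)" using i2 by (metis cong_sym cong_trans)
    then have "int p dvd 2" by (simp add: cong_iff_dvd_diff)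
    then show False using p2 by (auto dest: zdvd_imp_le)
  qed
  have "[(i + 1) ^ (p - 1) = 1] (mod p)"
  proof (rule fermat_theorem[OF p])
    show "\<not> p dvd i + 1" using not_dvd by (metis of_nat_dvd_iff of_nat_add of_nat_1)
  qed
  then have "[int ((i + 1) ^ (p - 1)) = int 1] (mod int p)" by (simp only: cong_int_iff)
  then have one: "[((int i + 1)\<^sup>2) ^ m = 1] (mod int p)"
    by (simp only: p1 power_mult of_nat_power of_nat_add of_nat_1)
  have "[(int i + 1)\<^sup>2 = 2 * int i] (mod int p)"
  proof -
    have "(int i + 1)\<^sup>2 - 2 * int i = int i ^ 2 + 1" by (simp add: power2_eq_square algebra_simps)
    then show ?thesis using dvd by (simp only: cong_iff_dvd_diff)
  qed
  then have "[((int i + 1)\<^sup>2) ^ m = 2 ^ m * int i ^ m] (mod int p)"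
    using cong_pow[of "(int i + 1)\<^sup>2" "2 * int i" "int p" m] by (simp add: power_mult_distrib)
  moreover have "[2 ^ m * int i ^ m = 1 * (- 1)] (mod int p)"
  proof (rule cong_mult)
    show "[2 ^ m = 1] (mod int p)"
      using two_m by (metis cong_int_iff of_nat_1 of_nat_numeral of_nat_power)
    have "[(int i ^ 2) ^ (2 * k + 1) = (- 1) ^ (2 * k + 1)] (mod int p)"
      using i2 by (rule cong_pow)
    moreover have "m = 2 * (2 * k + 1)" by (simp add: m_def)
    then have "(int i ^ 2) ^ (2 * k + 1) = int i ^ m" by (simp only: power_mult)
    ultimately show "[int i ^ m = - 1] (mod int p)" by simp
  qed
  ultimately have "[1 = - 1] (mod int p)"
    using one by (metis cong_sym cong_trans mult_1)
  then have "int p dvd 2" by (simp add: cong_iff_dvd_diff)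
  then show False using p2 by (auto dest: zdvd_imp_le)
qed

subsection \<open>Generalized cyclotomic classes\<close>

text \<open>In an exponent of \<open>\<beta>\<close>, a factor \<open>p\<close> reduces the modulus
  of the other factor to \<open>q\<close>.\<close>

lemma cong_cmult_if_dvd:
  fixes u :: nat
  assumes "p dvd u" and "[a = b] (mod q)"
  shows "[u * a = u * b] (mod (p * q))"
proof -
  obtain v where v: "u = p * v" using \<open>p dvd u\<close> by blast
  have "[v * a = v * b] (mod q)" using assms(2) by (intro cong_mult cong_refl)
  then show ?thesis by (simp add: v cong_def mult.assoc mod_mult_mult1)
qed

text \<open>\<open>G\<close> and \<open>H\<close> are natural representatives of \<open>g\<close>
  and \<open>h\<close> modulo \<open>p * q\<close>; with them all exponents of
  \<open>\<beta>\<close> are natural numbers.\<close>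

locale cyclotomic_order_4 =
  fixes p q G H l :: nat and \<beta> :: "'a::comm_ring_1"
  assumes prime_p: "prime p" and prime_q: "prime q" and neq: "p \<noteq> q"
    and gcd_eq: "gcd (p - 1) (q - 1) = 4"
    and primroot_p: "residue_primroot p G" and primroot_q: "residue_primroot q G"
    and H_mod_p: "[H = G] (mod p)" and H_mod_q: "[H = 1] (mod q)"
    and ring: "galois_subring (UNIV :: 'a set) l"
    and order_\<beta>: "has_mult_order \<beta> (p * q)"
begin

sublocale galois_subring "UNIV :: 'a set" l by (rule ring)

abbreviation e :: nat where "e \<equiv> cyc_e p q"

lemma coprime_pq: "coprime p q" "coprime q p"
  using primes_coprime prime_p prime_q neq by blast+

lemma four_dvd: "4 dvd p - 1" "4 dvd q - 1"
  using gcd_dvd1[of "p - 1" "q - 1"] gcd_dvd2[of "p - 1" "q - 1"] by (simp_all only: gcd_eq)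

lemma p_gt_1: "p > 1" and q_gt_1: "q > 1"
  using prime_p prime_q prime_gt_1_nat by auto

lemma odd_p: "odd p" and odd_q: "odd q"
  using four_dvd p_gt_1 q_gt_1 by presburger+

lemma e_eq: "e = (p - 1) div 4 * (q - 1)" "e = (q - 1) div 4 * (p - 1)" "4 * e = (p - 1) * (q - 1)"
  using four_dvd by (auto simp: cyc_e_def elim!: dvdE)

text \<open>With gcd 4, a quarter of the product is the lcm, which is the order of \<open>G\<close>
  modulo \<open>p * q\<close>; thus \<open>s < e\<close> runs through the group of \<open>G\<close>
  exactly once.\<close>

lemma e_eq_lcm: "e = lcm (p - 1) (q - 1)"
proof -
  have "4 * e = 4 * lcm (p - 1) (q - 1)"
    using prod_gcd_lcm_nat[of "p - 1" "q - 1"] by (simp only: gcd_eq e_eq(3))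
  then show ?thesis by simp
qed

lemma coprime_G: "coprime p G" "coprime q G" "coprime (p * q) G"
  using primroot_p primroot_q by (auto simp: residue_primroot_def)

lemma ord_p_G: "ord p G = p - 1" and ord_q_G: "ord q G = q - 1"
  using primroot_p primroot_q prime_p prime_q by (auto simp: residue_primroot_def totient_prime)

lemma ord_pq_G: "ord (p * q) G = e"
  using coprime_pq by (simp add: ord_modulus_mult_coprime ord_p_G ord_q_G e_eq_lcm)

lemma coprime_H: "coprime (p * q) H"
proof -
  have "coprime p H" using coprime_G(1) cong_imp_coprime[OF cong_sym[OF H_mod_p]] by (simp add: coprime_commute)
  moreover have "coprime q H" using cong_imp_coprime[OF cong_sym[OF H_mod_q]] by (simp add: coprime_commute)
  ultimately show ?thesis by simp
qed

lemma G_H_mod_p: "[G ^ s * H ^ i = G ^ (s + i)] (mod p)"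
  unfolding power_add using H_mod_p by (intro cong_mult cong_pow cong_refl)

lemma G_H_mod_q: "[G ^ s * H ^ i = G ^ s] (mod q)"
  using cong_mult[OF cong_refl cong_pow[OF H_mod_q], of "G ^ s" i] by simp

lemma cong_pq_iff: "[a = b] (mod (p * q)) \<longleftrightarrow> [a = b] (mod p) \<and> [a = b] (mod q)" for a b :: nat
  using coprime_cong_mult_nat[OF _ _ coprime_pq(1)] cong_modulus_mult_nat
  by (metis mult.commute)

text \<open>By the Chinese remainder theorem \<open>G ^ s * H ^ i\<close> corresponds to the pair of
  discrete logarithms \<open>s + i\<close> modulo \<open>p - 1\<close> and \<open>s\<close> modulo
  \<open>q - 1\<close>: the factor \<open>H\<close> moves only the first one.\<close>

lemma G_H_cong_iff:
  "[G ^ s * H ^ i = G ^ t * H ^ j] (mod (p * q)) \<longleftrightarrow>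
     [s + i = t + j] (mod (p - 1)) \<and> [s = t] (mod (q - 1))"
proof -
  have "[G ^ s * H ^ i = G ^ t * H ^ j] (mod p) \<longleftrightarrow> [G ^ (s + i) = G ^ (t + j)] (mod p)"
    using G_H_mod_p by (metis cong_sym cong_trans)
  moreover have "[G ^ s * H ^ i = G ^ t * H ^ j] (mod q) \<longleftrightarrow> [G ^ s = G ^ t] (mod q)"
    using G_H_mod_q by (metis cong_sym cong_trans)
  ultimately show ?thesis
    using order_divides_expdiff coprime_G ord_p_G ord_q_G by (simp add: cong_pq_iff)
qed

lemma G_H_cong_imp_eq:
  assumes "[G ^ s * H ^ i = G ^ t * H ^ j] (mod (p * q))" "s < e" "t < e" "i < 4" "j < 4"
  shows "s = t \<and> i = j"
proof -
  have *: "[s + i = t + j] (mod (p - 1))" "[s = t] (mod (q - 1))"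
    using assms(1) by (simp_all add: G_H_cong_iff)
  \<comment> \<open>4 divides both moduli, so the index can be isolated modulo 4. Once
    \<open>i = j\<close>, the congruences for \<open>s\<close> and \<open>t\<close> combine modulo
    the lcm \<open>e\<close>.\<close>
  have "[s + i = t + j] (mod 4)" "[s = t] (mod 4)"
    using * four_dvd cong_dvd_modulus_nat by blast+
  then have "[t + i = t + j] (mod 4)"
    using cong_add[OF cong_sym cong_refl] cong_trans by blast
  then have "[i = j] (mod 4)" by (simp only: cong_add_lcancel_nat)
  then have "i = j" using assms(4,5) by (rule cong_less_modulus_unique_nat)
  then have "[s = t] (mod (p - 1))" using *(1) by (simp add: cong_add_rcancel_nat)
  then have "[s = t] (mod e)" using *(2) unfolding e_eq_lcm by (simp add: cong_cong_lcm_nat)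
  then have "s = t" using assms(2,3) by (rule cong_less_modulus_unique_nat)
  with \<open>i = j\<close> show ?thesis by simp
qed

lemma pq: "1 < p * q"
  using p_gt_1 q_gt_1 by (metis less_1_mult)

lemma mod_in_totatives:
  assumes "coprime x (p * q)"
  shows "x mod (p * q) \<in> totatives (p * q)"
proof -
  have "p * q \<noteq> 0" using pq by linarith
  then have cop: "coprime (x mod (p * q)) (p * q)" and le: "x mod (p * q) \<le> p * q"
    using assms coprime_mod_left_iff by (blast, simp)
  moreover have "x mod (p * q) \<noteq> 0"
  proof
    assume "x mod (p * q) = 0"
    then have "p * q = 1" using cop by (simp only: coprime_0_left_iff nat_dvd_1_iff_1)
    then show False using pq by simp
  qed
  ultimately show ?thesis by (simp add: in_totatives_iff)
qed

text \<open>This is the partition of the unit group into the four classes. Injectivity suffices,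
  because \<open>4 * e\<close> is the totient of \<open>p * q\<close>.\<close>

lemma bij_betw_totatives:
  "bij_betw (\<lambda>(i, s). (G ^ s * H ^ i) mod (p * q)) ({..<4} \<times> {..<e}) (totatives (p * q))"
proof -
  let ?f = "\<lambda>(i, s). (G ^ s * H ^ i) mod (p * q)"
  have inj: "inj_on ?f ({..<4} \<times> {..<e})"
  proof (rule inj_onI)
    fix x y assume mem: "x \<in> {..<4} \<times> {..<e}" "y \<in> {..<4} \<times> {..<e}" and eq: "?f x = ?f y"
    obtain i s j t where xy: "x = (i, s)" "y = (j, t)" by (cases x, cases y)
    have "[G ^ s * H ^ i = G ^ t * H ^ j] (mod (p * q))"
      using eq by (simp only: xy prod.case cong_def)
    then show "x = y" using G_H_cong_imp_eq mem xy by blast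
  qed
  have cop: "coprime (G ^ s * H ^ i) (p * q)" for s i
    using coprime_G(3) coprime_H by (metis coprime_commute coprime_mult_left_iff coprime_power_left_iff)
  have "?f ` ({..<4} \<times> {..<e}) \<subseteq> totatives (p * q)"
  proof clarify
    fix i s
    show "(G ^ s * H ^ i) mod (p * q) \<in> totatives (p * q)" by (rule mod_in_totatives[OF cop])
  qed
  moreover have "card (?f ` ({..<4} \<times> {..<e})) = card (totatives (p * q))"
  proof -
    have "card (totatives (p * q)) = totient p * totient q"
      using coprime_pq totient_mult_coprime by (simp flip: totient_def)
    then show ?thesis
      using e_eq(3) prime_p prime_q by (simp add: card_image[OF inj] totient_prime)
  qed
  ultimately have "?f ` ({..<4} \<times> {..<e}) = totatives (p * q)"
    by (intro card_subset_eq) simp_all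
  with inj show ?thesis by (simp add: bij_betw_def)
qed

lemma ex_G_H_cong:
  assumes "coprime x (p * q)"
  obtains s i where "s < e" "i < 4" "[x = G ^ s * H ^ i] (mod (p * q))"
proof -
  have "x mod (p * q) \<in> totatives (p * q)" using assms by (rule mod_in_totatives)
  then have "x mod (p * q) \<in> (\<lambda>(i, s). (G ^ s * H ^ i) mod (p * q)) ` ({..<4} \<times> {..<e})"
    using bij_betw_totatives by (simp add: bij_betw_def)
  then show thesis using that by (auto simp: cong_def)
qed

text \<open>If \<open>H ^ 4\<close> is \<open>G ^ w * H ^ j\<close>, comparing discrete logarithms
  gives \<open>w = 0\<close> modulo \<open>q - 1\<close> and \<open>w + j = 4\<close> modulo
  \<open>p - 1\<close>. So 4 divides \<open>w\<close> and \<open>w + j\<close>, hence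
  \<open>j\<close>.\<close>

lemma H_power_4: obtains w where "[H ^ 4 = G ^ w] (mod (p * q))"
proof -
  have "coprime (H ^ 4) (p * q)" using coprime_H by (simp add: coprime_commute)
  then obtain w j where wj: "j < 4" "[H ^ 4 = G ^ w * H ^ j] (mod (p * q))"
    using ex_G_H_cong by metis
  then have "[0 + 4 = w + j] (mod (p - 1))" "[0 = w] (mod (q - 1))"
    using G_H_cong_iff[of 0 4 w j] by simp_all
  then have "[0 + 4 = w + j] (mod 4)" "[0 = w] (mod 4)"
    using four_dvd cong_dvd_modulus_nat by blast+
  then have "4 dvd w" "4 dvd w + j" by (simp_all add: cong_def mod_eq_0_iff_dvd)
  then have "j = 0" using wj(1) by presburger
  then show thesis using that wj(2) by simp
qed

lemma sixteen_cong: obtains w where "[16 = G ^ w] (mod (p * q))"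
proof -
  have "coprime 2 (p * q)" using odd_p odd_q by simp
  then obtain s i where si: "[2 = G ^ s * H ^ i] (mod (p * q))" by (rule ex_G_H_cong)
  obtain w where w: "[H ^ 4 = G ^ w] (mod (p * q))" by (rule H_power_4)
  have "[2 ^ 4 = (G ^ s * H ^ i) ^ 4] (mod (p * q))" using si by (rule cong_pow)
  also have "(G ^ s * H ^ i) ^ 4 = G ^ (s * 4) * (H ^ 4) ^ i"
    by (simp add: power_mult_distrib mult.commute flip: power_mult)
  also have "[\<dots> = G ^ (s * 4) * (G ^ w) ^ i] (mod (p * q))"
    using w by (intro cong_mult cong_refl cong_pow)
  also have "G ^ (s * 4) * (G ^ w) ^ i = G ^ (s * 4 + w * i)"
    by (simp add: power_add power_mult)
  finally show thesis using that by simp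
qed

subsection \<open>Gaussian periods\<close>

text \<open>The value at \<open>\<beta> ^ u\<close> of the generating polynomial of the class with index \<open>j\<close>.\<close>

definition period :: "nat \<Rightarrow> nat \<Rightarrow> 'a" where
  "period u j = (\<Sum>s<e. \<beta> ^ (u * (G ^ s * H ^ j)))"

lemmas \<beta>_cong = power_cong[OF order_\<beta>]

lemma \<beta>_eq_1_iff: "\<beta> ^ m = 1 \<longleftrightarrow> p * q dvd m"
  by (rule has_mult_order_power_eq_iff(2)[OF order_\<beta>])

lemma sum_class:
  fixes f :: "nat \<Rightarrow> 'b::comm_monoid_add"
  assumes "i < 4"
  shows "(\<Sum>u\<in>(\<lambda>s. (G ^ s * H ^ i) mod (p * q)) ` {..<e}. f u)
         = (\<Sum>s<e. f ((G ^ s * H ^ i) mod (p * q)))"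
proof (rule sum.reindex_cong[OF _ refl refl])
  show "inj_on (\<lambda>s. (G ^ s * H ^ i) mod (p * q)) {..<e}"
  proof (rule inj_onI)
    fix s t assume "s \<in> {..<e}" "t \<in> {..<e}"
      "(G ^ s * H ^ i) mod (p * q) = (G ^ t * H ^ i) mod (p * q)"
    then show "s = t"
      using G_H_cong_imp_eq[of s i t i] assms by (simp only: cong_def lessThan_iff)
  qed
qed

lemma period_1: "(\<Sum>s<e. \<beta> ^ ((G ^ s * H ^ i) mod (p * q))) = period 1 i"
  unfolding period_def by (intro sum.cong refl \<beta>_cong) simp

lemma period_shift: "period (G ^ t * x) j = period x j"
proof -
  have "(\<Sum>s<ord (p * q) G. \<beta> ^ (x * (G ^ t * G ^ s * H ^ j)))
      = (\<Sum>s<ord (p * q) G. \<beta> ^ (x * (G ^ s * H ^ j)))"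
    by (rule sum_powers_mult_generator[where F = "\<lambda>y. \<beta> ^ (x * (y * H ^ j))"
          and b = "G ^ t" and m = t])
      (auto intro!: \<beta>_cong cong_mult coprime_G)
  then show ?thesis by (simp add: period_def ord_pq_G ac_simps)
qed

lemma period_cong: "[x = y] (mod (p * q)) \<Longrightarrow> period x j = period y j"
  unfolding period_def by (intro sum.cong refl \<beta>_cong cong_mult cong_refl)

lemma period_H: "period (H ^ i * x) j = period x (i + j)"
  by (simp add: period_def power_add ac_simps)

lemma period_add_4: "period x (4 + j) = period x j"
proof -
  obtain w where "[H ^ 4 = G ^ w] (mod (p * q))" by (rule H_power_4)
  then have "period (H ^ 4 * x) j = period (G ^ w * x) j"
    by (intro period_cong cong_mult cong_refl)
  then show ?thesis by (simp add: period_H period_shift)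
qed

lemma period_G_H: "[u = G ^ t * H ^ i] (mod (p * q)) \<Longrightarrow> period u j = period 1 (i + j)"
  using period_cong[of u "G ^ t * H ^ i" j] period_shift[of t "H ^ i" j] period_H[of i 1 j] by simp

lemma sum_periods: "(\<Sum>j<4. period 1 j) = 1"
proof -
  have root: "\<beta> ^ (p * q) = 1" using order_\<beta> by (simp add: has_mult_order_def)
  have mult_p: "sum (\<lambda>x. \<beta> ^ x) ((\<lambda>k. p * k) ` {..<q}) = 0"
  proof -
    have "sum (\<lambda>x. \<beta> ^ x) ((\<lambda>k. p * k) ` {..<q}) = (\<Sum>k<q. (\<beta> ^ p) ^ k)"
      using p_gt_1 by (subst sum.reindex) (auto simp: inj_on_def power_mult)
    also have "\<dots> = 0"
      using odd_q root p_gt_1 q_gt_1 \<beta>_eq_1_iff[of p]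
      by (intro sum_powers_root_of_unity) (auto dest: dvd_imp_le simp flip: power_mult)
    finally show ?thesis .
  qed
  have mult_q: "sum (\<lambda>x. \<beta> ^ x) ((\<lambda>k. q * k) ` {..<p}) = 0"
  proof -
    have "sum (\<lambda>x. \<beta> ^ x) ((\<lambda>k. q * k) ` {..<p}) = (\<Sum>k<p. (\<beta> ^ q) ^ k)"
      using q_gt_1 by (subst sum.reindex) (auto simp: inj_on_def power_mult)
    also have "\<dots> = 0"
      using odd_p root p_gt_1 q_gt_1 \<beta>_eq_1_iff[of q]
      by (intro sum_powers_root_of_unity) (auto dest: dvd_imp_le simp: mult.commute simp flip: power_mult)
    finally show ?thesis .
  qed
  have inter: "(\<lambda>k. p * k) ` {..<q} \<inter> (\<lambda>k. q * k) ` {..<p} = {0}"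
  proof
    show "(\<lambda>k. p * k) ` {..<q} \<inter> (\<lambda>k. q * k) ` {..<p} \<subseteq> {0}"
    proof clarsimp
      fix k m assume eq: "p * k = q * m" and "k < q"
      have "q dvd p * k" by (simp add: eq)
      then have "q dvd k" using coprime_pq by (simp add: coprime_dvd_mult_right_iff)
      then show "m = 0" using \<open>k < q\<close> eq q_gt_1 by (auto dest: dvd_imp_le)
    qed
  qed (use p_gt_1 q_gt_1 in force)
  have "{..<p * q} = totatives (p * q) \<union> ((\<lambda>k. p * k) ` {..<q} \<union> (\<lambda>k. q * k) ` {..<p})"
    (is "_ = _ \<union> ?M")
  proof (intro equalityI subsetI)
    fix x assume x: "x \<in> {..<p * q}"
    show "x \<in> totatives (p * q) \<union> ?M"
    proof (cases "p dvd x \<or> q dvd x")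
      case True
      then show ?thesis using x by (auto elim!: dvdE)
    next
      case False
      then have "coprime x (p * q)"
        using prime_imp_coprime[OF prime_p, of x] prime_imp_coprime[OF prime_q, of x]
        by (simp add: coprime_commute)
      moreover have "x > 0" using False by (auto intro: gr0I)
      ultimately show ?thesis using x by (simp add: in_totatives_iff)
    qed
  next
    fix x assume "x \<in> totatives (p * q) \<union> ?M"
    then show "x \<in> {..<p * q}"
      using totatives_less[OF _ pq] p_gt_1 q_gt_1 by (auto simp: mult.commute)
  qed
  moreover have "totatives (p * q) \<inter> ?M = {}"
    using p_gt_1 q_gt_1 by (auto simp: in_totatives_iff)
  ultimately have "(\<Sum>x<p * q. \<beta> ^ x) = (\<Sum>x\<in>totatives (p * q). \<beta> ^ x) + (\<Sum>x\<in>?M. \<beta> ^ x)"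
    by (simp add: sum.union_disjoint)
  \<comment> \<open>The multiples of \<open>p\<close> and those of \<open>q\<close> each contribute
    0, but their union counts the common term \<open>\<beta> ^ 0 = 1\<close> only once.\<close>
  moreover have "(\<Sum>x\<in>?M. \<beta> ^ x) = - 1"
    using sum.union_inter[of "(\<lambda>k. p * k) ` {..<q}" "(\<lambda>k. q * k) ` {..<p}" "\<lambda>x. \<beta> ^ x"]
    by (simp add: inter mult_p mult_q eq_neg_iff_add_eq_0)
  moreover have "(\<Sum>x<p * q. \<beta> ^ x) = 0"
    using odd_p odd_q root \<beta>_eq_1_iff[of 1] pq by (intro sum_powers_root_of_unity) auto
  ultimately have "1 = (\<Sum>x\<in>totatives (p * q). \<beta> ^ x)" by simp
  also have "\<dots> = (\<Sum>x\<in>{..<4} \<times> {..<e}. \<beta> ^ (case x of (i, s) \<Rightarrow> (G ^ s * H ^ i) mod (p * q)))"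
    by (rule sum.reindex_bij_betw[symmetric, OF bij_betw_totatives])
  also have "\<dots> = (\<Sum>i<4. \<Sum>s<e. \<beta> ^ ((G ^ s * H ^ i) mod (p * q)))"
    by (simp add: sum.cartesian_product case_prod_unfold)
  finally show ?thesis by (simp add: period_1)
qed

text \<open>A Ramanujan sum: \<open>\<beta> ^ u\<close> is a \<open>p\<close>-th root of unity, and
  \<open>G ^ s\<close> runs through the nonzero residues modulo \<open>p\<close>.\<close>

lemma sum_primroot_p:
  assumes "q dvd u"
  shows "(\<Sum>s<p - 1. \<beta> ^ (u * G ^ s)) = (if p dvd u then of_nat (p - 1) else - 1)"
proof -
  have "(\<Sum>s<p - 1. \<beta> ^ (u * G ^ s)) = (\<Sum>x\<in>{0<..<p}. \<beta> ^ (u * x))"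
    using cong_cmult_if_dvd[OF assms, of _ _ p]
    by (intro sum_primroot_powers prime_p primroot_p \<beta>_cong) (simp add: mult.commute[of p])
  also have "\<dots> = (\<Sum>x\<in>{0<..<p}. (\<beta> ^ u) ^ x)" by (simp add: power_mult)
  also have "\<dots> = (if p dvd u then of_nat (p - 1) else - 1)"
  proof (cases "p dvd u")
    case True
    then have "\<beta> ^ u = 1" using assms coprime_pq by (simp add: \<beta>_eq_1_iff divides_mult)
    then show ?thesis using True by simp
  next
    case False
    then have "\<beta> ^ u \<noteq> 1" unfolding \<beta>_eq_1_iff by (auto intro: dvd_mult_left)
    moreover have "(\<beta> ^ u) ^ p = 1"
      using assms unfolding power_mult[symmetric] \<beta>_eq_1_iff by (simp add: mult.commute)
    ultimately show ?thesis using False odd_p sum_nonzero_powers_root_of_unity by simp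
  qed
  finally show ?thesis .
qed

lemma sum_primroot_q:
  assumes "p dvd u"
  shows "(\<Sum>s<q - 1. \<beta> ^ (u * G ^ s)) = (if q dvd u then of_nat (q - 1) else - 1)"
proof -
  have "(\<Sum>s<q - 1. \<beta> ^ (u * G ^ s)) = (\<Sum>x\<in>{0<..<q}. \<beta> ^ (u * x))"
    using cong_cmult_if_dvd[OF assms, of _ _ q]
    by (intro sum_primroot_powers prime_q primroot_q \<beta>_cong) simp
  also have "\<dots> = (\<Sum>x\<in>{0<..<q}. (\<beta> ^ u) ^ x)" by (simp add: power_mult)
  also have "\<dots> = (if q dvd u then of_nat (q - 1) else - 1)"
  proof (cases "q dvd u")
    case True
    then have "\<beta> ^ u = 1" using assms coprime_pq by (simp add: \<beta>_eq_1_iff divides_mult)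
    then show ?thesis using True by simp
  next
    case False
    then have "\<beta> ^ u \<noteq> 1" unfolding \<beta>_eq_1_iff by (auto intro: dvd_mult_right)
    moreover have "(\<beta> ^ u) ^ q = 1"
      using assms unfolding power_mult[symmetric] \<beta>_eq_1_iff by (simp add: mult_dvd_mono)
    ultimately show ?thesis using False odd_q sum_nonzero_powers_root_of_unity by simp
  qed
  finally show ?thesis .
qed

text \<open>Only residues modulo \<open>q\<close> matter here. There \<open>H\<close> is 1, which
  removes \<open>j\<close>, and \<open>G ^ s\<close> repeats after \<open>q - 1\<close> steps, so
  the \<open>e\<close> terms run \<open>(p - 1) div 4\<close> times through all nonzero
  residues.\<close>

lemma period_dvd_p:
  assumes "p dvd u"
  shows "period u j = of_nat ((p - 1) div 4) * (if q dvd u then of_nat (q - 1) else - 1)"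
proof -
  have "period u j = (\<Sum>s<e. \<beta> ^ (u * G ^ s))"
    unfolding period_def using assms G_H_mod_q by (intro sum.cong refl \<beta>_cong cong_cmult_if_dvd)
  also have "\<dots> = of_nat ((p - 1) div 4) * (\<Sum>s<q - 1. \<beta> ^ (u * G ^ s))"
    unfolding e_eq(1)
  proof (rule sum_lessThan_mult)
    fix s
    have "[G ^ (s + (q - 1)) = G ^ s] (mod q)"
      using order_divides_expdiff[OF coprime_G(2)] by (simp add: ord_q_G cong_def)
    then show "\<beta> ^ (u * G ^ (s + (q - 1))) = \<beta> ^ (u * G ^ s)"
      using assms by (intro \<beta>_cong cong_cmult_if_dvd)
  qed
  finally show ?thesis by (simp only: sum_primroot_q[OF assms])
qed

lemma period_dvd_q:
  assumes "q dvd u"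
  shows "period u j = of_nat ((q - 1) div 4) * (if p dvd u then of_nat (p - 1) else - 1)"
proof -
  have cong: "[u * a = u * b] (mod (p * q))" if "[a = b] (mod p)" for a b
    using cong_cmult_if_dvd[OF assms that] by (simp add: mult.commute)
  \<comment> \<open>Modulo \<open>p\<close> the factor \<open>H ^ j\<close> acts as
    \<open>G ^ j\<close>; absorbed into \<open>u\<close>, it changes none of the divisibilities on
    which the sum depends.\<close>
  have "period u j = (\<Sum>s<e. \<beta> ^ (u * G ^ j * G ^ s))"
    unfolding period_def using G_H_mod_p[of _ j]
    by (intro sum.cong refl \<beta>_cong) (simp only: mult.assoc cong add.commute flip: power_add)
  also have "\<dots> = of_nat ((q - 1) div 4) * (\<Sum>s<p - 1. \<beta> ^ (u * G ^ j * G ^ s))"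
    unfolding e_eq(2)
  proof (rule sum_lessThan_mult)
    fix s
    have "[(j + s) + (p - 1) = j + s] (mod (p - 1))" by (simp only: cong_def mod_add_self2)
    then have "[G ^ ((j + s) + (p - 1)) = G ^ (j + s)] (mod p)"
      by (simp only: order_divides_expdiff[OF coprime_G(1)] ord_p_G)
    then have "[G ^ j * G ^ (s + (p - 1)) = G ^ j * G ^ s] (mod p)"
      by (simp only: power_add mult.assoc)
    then show "\<beta> ^ (u * G ^ j * G ^ (s + (p - 1))) = \<beta> ^ (u * G ^ j * G ^ s)"
      unfolding mult.assoc by (intro \<beta>_cong cong)
  qed
  also have "(\<Sum>s<p - 1. \<beta> ^ (u * G ^ j * G ^ s)) = (if p dvd u then of_nat (p - 1) else - 1)"
    using sum_primroot_p[of "u * G ^ j"] assms coprime_G(1)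
    by (simp add: coprime_dvd_mult_left_iff)
  finally show ?thesis .
qed

end

text \<open>One statement serves all traces: \<open>s = 1\<close> with \<open>n\<close> prime, and
  \<open>s = 4\<close> with \<open>n = p * q\<close>. The number \<open>r div s\<close> of terms in
  a trace is the order of \<open>2 ^ s\<close> modulo \<open>n\<close>, and the outer sum has as
  many terms as there are cosets.\<close>

lemma (in galois_subring) sum_TR_powers:
  assumes x: "x \<in> K" "x ^ n = 1" and r: "r = ord n 2" and s: "s dvd r"
    and g: "coprime n g" and two: "[2 ^ s = g ^ m] (mod n)"
  shows "(\<Sum>i<ord n g div (r div s). TR K s r (x ^ (g ^ i))) = (\<Sum>t<ord n g. x ^ (g ^ t))"
proof -
  have cong: "x ^ a = x ^ b" if "[a = b] (mod n)" for a b
  proof -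
    have "x ^ c = x ^ (c mod n)" for c
      using x(2) power_mult[of x n "c div n"] power_add[of x "n * (c div n)" "c mod n"] by simp
    then show ?thesis using that by (metis cong_def)
  qed
  have "s > 0" using s r_pos by (auto intro: gr0I)
  have "coprime n 2" using r r_pos by (metis ord_gt_0_iff)
  then have "ord n (2 ^ s) = r div s"
    using ord_power[of n 2 s] s by (simp add: r gcd_nat.absorb1)
  moreover have "TR K s r (x ^ (g ^ i)) = (\<Sum>k<r div s. x ^ (g ^ i * (2 ^ s) ^ k))" for i
  proof -
    have "[2 ^ r = 1] (mod n)" unfolding r by (rule ord)
    then have "x ^ (2 ^ r) = x ^ 1" by (rule cong)
    then have "(x ^ (g ^ i)) ^ (2 ^ r) = x ^ (g ^ i)"
      by (metis power_mult mult.commute power_one_right)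
    then have "TR K s r (x ^ (g ^ i)) = (\<Sum>k<r div s. (x ^ (g ^ i)) ^ ((2 ^ s) ^ k))"
      using x(1) power_mem by (intro TR_teichmueller)
    then show ?thesis by (simp only: power_mult)
  qed
  moreover have "(\<Sum>i<ord n g div ord n (2 ^ s). \<Sum>k<ord n (2 ^ s). x ^ (g ^ i * (2 ^ s) ^ k))
      = (\<Sum>t<ord n g. x ^ (g ^ t))"
    using cong g two by (rule sum_cosets)
  ultimately show ?thesis by simp
qed

section \<open>Trace sums of powers of the root of unity\<close>

context cyclotomic_order_4
begin

lemma ord_prime_dvd_ord: "ord p 2 dvd ord (p * q) 2" "ord q 2 dvd ord (p * q) 2"
  using coprime_pq by (simp_all add: ord_modulus_mult_coprime)

lemma primroot_generates_2:
  assumes "prime n" "odd n" "residue_primroot n G"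
  obtains m where "[2 = G ^ m] (mod n)"
proof -
  have "2 < n" using assms prime_gt_1_nat[of n] by presburger
  then have "2 \<in> (\<lambda>i. G ^ i mod n) ` {..<totient n}"
    using residue_primroot_is_generator[of n G] assms by (auto simp: bij_betw_def in_totatives_iff)
  then show thesis using that \<open>2 < n\<close> by (auto simp: cong_def)
qed

lemma sum_TR_prime:
  assumes n: "prime n" "odd n" "residue_primroot n G"
    and K: "galois_ring (ord n 2) K" and l: "ord n 2 dvd l" and w: "p * q dvd w * n"
  shows "(\<Sum>i<(n - 1) div ord n 2. TR K 1 (ord n 2) (\<beta> ^ (w * G ^ i))) = (\<Sum>s<n - 1. \<beta> ^ (w * G ^ s))"
proof -
  interpret K: galois_subring K "ord n 2" using K by (rule galois_ring_imp_subring)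
  have root: "(\<beta> ^ w) ^ n = 1" using w by (simp only: \<beta>_eq_1_iff flip: power_mult)
  have "n dvd 2 ^ ord n 2 - 1" using ord[of 2 n] by (simp add: cong_altdef_nat)
  then obtain c where "2 ^ ord n 2 - 1 = n * c" by blast
  then have "(2 :: nat) ^ ord n 2 = n * c + 1" by (metis le_add_diff_inverse2 one_le_numeral one_le_power)
  then have "(\<beta> ^ w) ^ (2 ^ ord n 2) = \<beta> ^ w" using root by (simp add: power_add power_mult)
  \<comment> \<open>For \<open>n = p\<close> the exponent \<open>w\<close> will be
    \<open>u * q\<close>, for \<open>n = q\<close> it will be \<open>u * p\<close>. As an
    \<open>n\<close>-th root of unity \<open>\<beta> ^ w\<close> is fixed by the power
    \<open>2 ^ ord n 2\<close>, and this places it in \<open>K\<close>.\<close>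
  then have mem: "\<beta> ^ w \<in> K"
    using fixed_by_power_mem_subring[OF ring K.galois_subring_axioms l] by blast
  have ord_G: "coprime n G" "ord n G = n - 1"
    using n by (auto simp: residue_primroot_def totient_prime)
  obtain m where "[2 = G ^ m] (mod n)" using n by (rule primroot_generates_2)
  then show ?thesis
    using K.sum_TR_powers[OF mem root refl one_dvd, of G m] ord_G by (simp add: power_mult)
qed

lemma sum_TR_p:
  assumes "l = ord (p * q) 2" "galois_ring (ord p 2) Kp"
  shows "(\<Sum>i<(p - 1) div ord p 2. TR Kp 1 (ord p 2) (\<beta> ^ (u * G ^ i * q)))
         = (if p dvd u then of_nat (p - 1) else - 1)"
proof -
  have "(\<Sum>i<(p - 1) div ord p 2. TR Kp 1 (ord p 2) (\<beta> ^ (u * q * G ^ i)))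
      = (\<Sum>s<p - 1. \<beta> ^ (u * q * G ^ s))"
    using assms ord_prime_dvd_ord prime_p odd_p primroot_p by (intro sum_TR_prime) auto
  also have "\<dots> = (if p dvd u then of_nat (p - 1) else - 1)"
    using sum_primroot_p[of "u * q"] coprime_pq by (simp add: coprime_dvd_mult_left_iff)
  finally show ?thesis by (simp only: mult.assoc mult.commute[of q])
qed

lemma sum_TR_q:
  assumes "l = ord (p * q) 2" "galois_ring (ord q 2) Kq"
  shows "(\<Sum>i<(q - 1) div ord q 2. TR Kq 1 (ord q 2) (\<beta> ^ (u * G ^ i * p)))
         = (if q dvd u then of_nat (q - 1) else - 1)"
proof -
  have "(\<Sum>i<(q - 1) div ord q 2. TR Kq 1 (ord q 2) (\<beta> ^ (u * p * G ^ i)))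
      = (\<Sum>s<q - 1. \<beta> ^ (u * p * G ^ s))"
    using assms ord_prime_dvd_ord prime_q odd_q primroot_q by (intro sum_TR_prime) auto
  also have "\<dots> = (if q dvd u then of_nat (q - 1) else - 1)"
    using sum_primroot_q[of "u * p"] coprime_pq by (simp add: coprime_dvd_mult_left_iff)
  finally show ?thesis by (simp only: mult.assoc mult.commute[of p])
qed

lemma sum_TR_pq:
  assumes l: "l = ord (p * q) 2" and "4 dvd l"
  shows "(\<Sum>i<4 * e div l. TR UNIV 4 l (\<beta> ^ (u * G ^ i * H ^ j))) = period u j"
proof -
  obtain m where m: "[16 = G ^ m] (mod (p * q))" by (rule sixteen_cong)
  have "(\<beta> ^ (u * H ^ j)) ^ (p * q) = 1" by (simp only: \<beta>_eq_1_iff dvd_triv_right flip: power_mult)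
  then have "(\<Sum>i<ord (p * q) G div (l div 4). TR UNIV 4 l ((\<beta> ^ (u * H ^ j)) ^ (G ^ i)))
      = (\<Sum>s<ord (p * q) G. (\<beta> ^ (u * H ^ j)) ^ (G ^ s))"
    using m by (intro sum_TR_powers[OF UNIV_I _ l \<open>4 dvd l\<close> coprime_G(3), of _ m]) simp_all
  \<comment> \<open>The order of 16 is \<open>l div 4\<close>, so both sides are the index of the
    group of 16 in the group of \<open>G\<close>.\<close>
  moreover have "4 * e div l = ord (p * q) G div (l div 4)"
  proof -
    obtain c where c: "l = 4 * c" using \<open>4 dvd l\<close> by blast
    show ?thesis by (simp add: c ord_pq_G)
  qed
  ultimately show ?thesis
    by (simp add: period_def ord_pq_G ac_simps flip: power_mult)
qed

section \<open>The weighted sum of periods\<close>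

definition \<rho> :: 'a where
  "\<rho> = period 1 1 + 2 * period 1 2 + 3 * period 1 3"

definition combination :: "nat \<Rightarrow> 'a" where
  "combination u = (\<Sum>j = 0..3. (\<rho> + 2 - of_nat j) * period u j)"

lemma of_nat_eq_0_if_4_dvd: "4 dvd n \<Longrightarrow> (of_nat n :: 'a) = 0"
  by (auto simp: four_eq_0 elim!: dvdE)

lemma minus_2: "- 2 = (2 :: 'a)"
  using four_eq_0 by (simp add: neg_eq_iff_add_eq_0)

lemma double_of_nat: "2 * (of_nat n :: 'a) = (if even n then 0 else 2)"
proof -
  obtain k where "n = 2 * k \<or> n = 2 * k + 1" by (metis oddE evenE)
  then show ?thesis
    by (auto simp: algebra_simps four_eq_0 simp flip: mult.assoc)
qed

text \<open>The subtracted part is the expression defining \<open>\<rho>\<close>, taken at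
  \<open>\<beta> ^ u\<close>; the evaluation thus compares \<open>\<rho>\<close> with its own
  transform.\<close>

lemma combination_expand:
  "combination u = (\<rho> + 2) * (\<Sum>j<4. period u j)
     - (period u 1 + 2 * period u 2 + 3 * period u 3)"
proof -
  have sets: "{0..3} = {0, 1, 2, 3 :: nat}" "{..<4} = {0, 1, 2, 3 :: nat}" by auto
  show ?thesis by (simp add: combination_def sets algebra_simps)
qed

lemma combination_const:
  assumes "\<And>j. period u j = c"
  shows "combination u = 2 * c"
proof -
  \<comment> \<open>The weights 1, 2, 3 add up to 6, split as 4 + 2 so that only
    \<open>- 2 * c\<close> survives.\<close>
  have "combination u = (\<rho> + 2) * (4 * c) - (4 * c + 2 * c)"
    by (simp add: combination_expand assms algebra_simps)
  also have "\<dots> = (- 2) * c" by (simp add: four_eq_0)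
  finally show ?thesis by (simp only: minus_2)
qed

text \<open>Only twice the period enters, so the sign of \<open>- 1\<close> disappears; when both
  primes divide \<open>u\<close>, the factor \<open>q - 1\<close> is 0 in characteristic 4.\<close>

lemma combination_dvd:
  assumes "p dvd u \<or> q dvd u"
  shows "combination u = (if p dvd u \<and> q dvd u then 0
     else if p dvd u then 2 * of_nat ((p - 1) div 4) else 2 * of_nat ((q - 1) div 4))"
proof -
  have zero: "of_nat (p - 1) = (0 :: 'a)" "of_nat (q - 1) = (0 :: 'a)"
    using four_dvd by (simp_all only: of_nat_eq_0_if_4_dvd)
  have neg: "2 * (x * - 1) = 2 * x" for x :: 'a
    using minus_2 by (metis mult.commute mult_1 mult_minus_left mult_minus_right)
  show ?thesis
  proof (cases "p dvd u")
    case True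
    then show ?thesis
      using combination_const[OF period_dvd_p[OF True]] by (simp add: zero[simplified] neg[simplified])
  next
    case False
    with assms have "q dvd u" by simp
    then show ?thesis
      using False combination_const[OF period_dvd_q] by (simp add: neg[simplified])
  qed
qed

lemma combination_unit:
  assumes u: "[u = G ^ t * H ^ i] (mod (p * q))" and "i < 4"
  shows "combination u = of_nat i + 2"
proof -
  have i: "i = 0 \<or> i = 1 \<or> i = 2 \<or> i = 3" using \<open>i < 4\<close> by linarith
  have per: "period u j = period 1 (i + j)" for j using u by (rule period_G_H)
  define x where "x = period 1"
  have wrap: "x 4 = x 0" "x 5 = x 1" "x 6 = x 2"
    using period_add_4[of 1 0] period_add_4[of 1 1] period_add_4[of 1 2] by (simp_all add: x_def)
  have set: "{..<4} = {0, 1, 2, 3 :: nat}" by auto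
  have sum: "x 0 + x 1 + x 2 + x 3 = 1"
    using sum_periods by (simp add: set x_def algebra_simps)
  have "(\<Sum>j<4. period u j) = 1"
  proof -
    have "(\<Sum>j<4. period u j) = x i + x (i + 1) + x (i + 2) + x (i + 3)"
      unfolding set per x_def by simp
    also have "\<dots> = x 0 + x 1 + x 2 + x 3" using i
      by (elim disjE) (simp_all add: wrap del: add_2_eq_Suc' flip: numeral_2_eq_2)
    finally show ?thesis by (simp only: sum)
  qed
  then have *: "combination u = \<rho> + 2 - (x (i + 1) + 2 * x (i + 2) + 3 * x (i + 3))"
    by (simp add: combination_expand per x_def)
  have \<rho>: "\<rho> = x 1 + 2 * x 2 + 3 * x 3" by (simp add: \<rho>_def x_def)
  have four: "4 * y = 0" for y :: 'a by (simp add: four_eq_0)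
  \<comment> \<open>In \<open>\<rho>\<close> the value \<open>x k\<close> has weight
    \<open>k\<close>, in the rotated sum it has weight \<open>k - i\<close> modulo 4. The difference
    is \<open>i\<close>, except for the wrapped indices \<open>k < i\<close>, where it is
    \<open>i - 4\<close>; this is the source of the multiples of 4 below.\<close>
  have "combination u - 2 = of_nat i"
    using i
  proof (elim disjE)
    assume i: "i = 0"
    then have idx: "i + 1 = 1" "i + 2 = 2" "i + 3 = 3" by simp_all
    show ?thesis unfolding * idx \<rho> by (simp add: i)
  next
    assume i: "i = 1"
    then have idx: "i + 1 = 2" "i + 2 = 3" "i + 3 = 4" by simp_all
    have "combination u - 2 = (x 0 + x 1 + x 2 + x 3) - 4 * x 0"
      unfolding * idx \<rho> wrap by (simp add: algebra_simps)
    then show ?thesis by (simp only: sum four i) simp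
  next
    assume i: "i = 2"
    then have idx: "i + 1 = 3" "i + 2 = 4" "i + 3 = 5" by simp_all
    have "combination u - 2 = 2 * (x 0 + x 1 + x 2 + x 3) - 4 * (x 0 + x 1)"
      unfolding * idx \<rho> wrap by (simp add: algebra_simps)
    then show ?thesis by (simp only: sum four i) simp
  next
    assume i: "i = 3"
    then have idx: "i + 1 = 4" "i + 2 = 5" "i + 3 = 6" by simp_all
    have "combination u - 2 = 3 * (x 0 + x 1 + x 2 + x 3) - 4 * (x 0 + x 1 + x 2)"
      unfolding * idx \<rho> wrap by (simp add: algebra_simps)
    then show ?thesis by (simp only: sum four i) simp
  qed
  then show ?thesis by (simp add: algebra_simps)
qed

section \<open>Values of the sequence\<close>

lemma dvd_mod_pq_iff: "p dvd u mod (p * q) \<longleftrightarrow> p dvd u" "q dvd u mod (p * q) \<longleftrightarrow> q dvd u"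
  by (simp_all add: dvd_mod_iff)

lemma mem_Q_R_iff: "u mod (p * q) \<in> Q_set p q \<union> R_set \<longleftrightarrow> q dvd u"
proof
  assume "u mod (p * q) \<in> Q_set p q \<union> R_set"
  then have "q dvd u mod (p * q)" by (auto simp: Q_set_def R_set_def)
  then show "q dvd u" by (simp only: dvd_mod_pq_iff)
next
  assume "q dvd u"
  then have "q dvd u mod (p * q)" by (simp only: dvd_mod_pq_iff)
  then obtain k where k: "u mod (p * q) = k * q" by (metis dvdE mult.commute)
  have "k * q < p * q" using pq mod_less_divisor[of "p * q" u] by (simp only: k)
  then have "k < p" by simp
  then show "u mod (p * q) \<in> Q_set p q \<union> R_set"
    unfolding k Q_set_def R_set_def by (cases "k = 0") auto
qed

lemma mem_P_iff:
  assumes "\<not> q dvd u"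
  shows "u mod (p * q) \<in> P_set p q \<longleftrightarrow> p dvd u"
proof
  assume "u mod (p * q) \<in> P_set p q"
  then have "p dvd u mod (p * q)" by (auto simp: P_set_def)
  then show "p dvd u" by (simp only: dvd_mod_pq_iff)
next
  assume "p dvd u"
  then have "p dvd u mod (p * q)" by (simp only: dvd_mod_pq_iff)
  then obtain k where k: "u mod (p * q) = k * p" by (metis dvdE mult.commute)
  have "k * p < q * p" using pq mod_less_divisor[of "p * q" u] by (simp only: k mult.commute)
  then have "k < q" by simp
  moreover have "k \<noteq> 0"
  proof
    assume "k = 0"
    then have "q dvd u mod (p * q)" by (simp only: k mult_zero_left dvd_0_right)
    then show False using assms by (simp only: dvd_mod_pq_iff)
  qed
  ultimately show "u mod (p * q) \<in> P_set p q"
    unfolding k P_set_def by auto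
qed

context
  fixes g h :: int
  assumes g: "[g = int G] (mod int (p * q))" and h: "[h = int H] (mod int (p * q))"
begin

lemma cyc_class_eq: "cyc_class p q g h i = (\<lambda>s. (G ^ s * H ^ i) mod (p * q)) ` {..<e}"
proof -
  have "nat ((g ^ s * h ^ i) mod int (p * q)) = (G ^ s * H ^ i) mod (p * q)" for s
  proof -
    have "[g ^ s * h ^ i = int (G ^ s * H ^ i)] (mod int (p * q))"
      unfolding of_nat_mult[of "G ^ s"] of_nat_power using g h by (intro cong_mult cong_pow)
    then have "(g ^ s * h ^ i) mod int (p * q) = int ((G ^ s * H ^ i) mod (p * q))"
      unfolding cong_def by (simp only: of_nat_mod)
    then show ?thesis by simp
  qed
  then show ?thesis by (auto simp: cyc_class_def)
qed

lemma poly_cyc_poly: "i < 4 \<Longrightarrow> poly (cyc_poly p q g h i) \<beta> = period 1 i"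
  by (simp add: cyc_poly_def poly_sum poly_monom cyc_class_eq sum_class period_1)

lemma quat_seq_dvd:
  assumes "p dvd u \<or> q dvd u"
  shows "quat_seq p q g h u = (if q dvd u then 2 else 0)"
  using assms mem_P_iff by (simp only: quat_seq_def mem_Q_R_iff) auto

lemma quat_seq_unit:
  assumes u: "[u = G ^ t * H ^ i] (mod (p * q))" and "t < e" "i < 4"
  shows "quat_seq p q g h u = of_nat i"
proof -
  have "coprime (G ^ t * H ^ i) (p * q)"
    using coprime_G(3) coprime_H by (metis coprime_commute coprime_mult_left_iff coprime_power_left_iff)
  then have cop: "coprime u (p * q)" using cong_imp_coprime[OF cong_sym[OF u]] by blast
  have "\<not> p dvd u" "\<not> q dvd u"
    using cop p_gt_1 q_gt_1 by (metis coprime_common_divisor_nat dvd_triv_left dvd_triv_right less_irrefl)+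
  moreover have "(THE i. i < 4 \<and> u mod (p * q) \<in> cyc_class p q g h i) = i"
  proof (rule the_equality)
    show "i < 4 \<and> u mod (p * q) \<in> cyc_class p q g h i"
      using assms by (auto simp: cyc_class_eq cong_def)
    fix j assume j: "j < 4 \<and> u mod (p * q) \<in> cyc_class p q g h j"
    then obtain s where "s < e" "u mod (p * q) = (G ^ s * H ^ j) mod (p * q)"
      by (auto simp: cyc_class_eq)
    then show "j = i" using G_H_cong_imp_eq[of s j t i] u j assms(2,3) by (metis cong_def)
  qed
  ultimately show ?thesis using mem_P_iff[of u] by (simp only: quat_seq_def mem_Q_R_iff if_False not_False_eq_True)
qed

end

end


section \<open>Comparison of the sequence with the trace formula\<close>

lemma Z4_emb_of_nat:
  assumes "(4 :: 'a::comm_ring_1) = 0"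
  shows "Z4_emb (of_nat n) = (of_nat n :: 'a)"
  using Z4_emb_of_int[OF assms, of "int n"] by simp

text \<open>In the first formula the two middle terms together give -4 = 0 at units, 2 if exactly
  one prime divides \<open>u\<close>, and 0 if both do. At units the leading 2 cancels the 2 in
  \<open>combination u = of_nat i + 2\<close>.\<close>

lemma (in cyclotomic_order_4) Z4_emb_quat_seq:
  assumes g: "[g = int G] (mod int (p * q))" and h: "[h = int H] (mod int (p * q))"
  shows "[p = 1] (mod 8) \<Longrightarrow> [q = 5] (mod 8) \<Longrightarrow>
      Z4_emb (quat_seq p q g h u) = 2 + 2 * (if p dvd u then of_nat (p - 1) else - 1)
        + 2 * (if q dvd u then of_nat (q - 1) else - 1) + combination u"
    and "[p = 5] (mod 8) \<Longrightarrow> [q = 1] (mod 8) \<Longrightarrow>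
      Z4_emb (quat_seq p q g h u) = 2 + combination u"
proof -
  note emb = Z4_emb_of_nat[OF four_eq_0]
  have emb_2: "Z4_emb 2 = (2 :: 'a)" and emb_0: "Z4_emb 0 = (0 :: 'a)"
    using emb[of 2] emb[of 0] by simp_all
  have zero: "of_nat (p - 1) = (0 :: 'a)" "of_nat (q - 1) = (0 :: 'a)"
    using four_dvd by (simp_all only: of_nat_eq_0_if_4_dvd)
  have "2 + 2 = (0 :: 'a)" using four_eq_0 by simp
  moreover have "2 + (x + 2) = x + (2 + 2)" for x :: 'a by (simp only: ac_simps)
  ultimately have two: "2 + 2 = (0 :: 'a)" "2 * (- 1) = (2 :: 'a)" "2 + (x + 2) = x" for x :: 'a
    using minus_2 by (simp_all only: add_0_right mult_minus_right mult_1_right)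
  have unit: thesis
    if "\<not> p dvd u" "\<not> q dvd u"
      and *: "\<And>i. Z4_emb (quat_seq p q g h u) = (of_nat i :: 'a) \<Longrightarrow> combination u = of_nat i + 2 \<Longrightarrow> thesis"
    for thesis
  proof -
    have "coprime u (p * q)"
      using prime_imp_coprime[OF prime_p that(1)] prime_imp_coprime[OF prime_q that(2)]
      by (simp add: coprime_commute)
    then obtain t i where ti: "t < e" "i < 4" "[u = G ^ t * H ^ i] (mod (p * q))" by (rule ex_G_H_cong)
    show thesis
      using *[of i] quat_seq_unit[OF g h ti(3) ti(1,2)] combination_unit[OF ti(3,2)] emb by simp
  qed
  have even: "even ((n - 1) div 4)" if "[n = 1] (mod 8)" "n > 1" for n :: nat
  proof -
    have "8 dvd n - 1" using cong_to_1_nat[OF that(1)] .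
    then obtain k where "n - 1 = 8 * k" by (rule dvdE)
    then have "(n - 1) div 4 = 2 * k" by presburger
    then show ?thesis by simp
  qed
  have odd: "odd ((n - 1) div 4)" if "[n = 5] (mod 8)" for n :: nat
  proof -
    have "n = 8 * (n div 8) + 5" using that div_mult_mod_eq[of n 8] by (simp add: cong_def)
    then have "(n - 1) div 4 = 2 * (n div 8) + 1" by linarith
    then show ?thesis by simp
  qed
  {
    assume mod8: "[p = 1] (mod 8)" "[q = 5] (mod 8)"
    show "Z4_emb (quat_seq p q g h u) = 2 + 2 * (if p dvd u then of_nat (p - 1) else - 1)
        + 2 * (if q dvd u then of_nat (q - 1) else - 1) + combination u"
    proof (cases "p dvd u \<or> q dvd u")
      case True
      show ?thesis
        using True even[OF mod8(1) p_gt_1] odd[OF mod8(2)]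
        unfolding quat_seq_dvd[OF g h True] combination_dvd[OF True] zero double_of_nat
        by (cases "p dvd u"; cases "q dvd u") (simp_all only: two emb_0 emb_2 if_True if_False simp_thms mult_zero_right add_0_right add_0_left)
    next
      case False
      then obtain i where "Z4_emb (quat_seq p q g h u) = (of_nat i :: 'a)" "combination u = of_nat i + 2"
        using unit by blast
      then show ?thesis using False by (simp only: two if_False simp_thms de_Morgan_disj add_0_left)
    qed
  next
    assume mod8: "[p = 5] (mod 8)" "[q = 1] (mod 8)"
    show "Z4_emb (quat_seq p q g h u) = 2 + combination u"
    proof (cases "p dvd u \<or> q dvd u")
      case True
      show ?thesis
        using True even[OF mod8(2) q_gt_1] odd[OF mod8(1)]
        unfolding quat_seq_dvd[OF g h True] combination_dvd[OF True] zero double_of_nat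
        by (cases "p dvd u"; cases "q dvd u") (simp_all only: two emb_0 emb_2 if_True if_False simp_thms mult_zero_right add_0_right add_0_left)
    next
      case False
      then obtain i where "Z4_emb (quat_seq p q g h u) = (of_nat i :: 'a)" "combination u = of_nat i + 2"
        using unit by blast
      then show ?thesis by (simp only: two)
    qed
  }
qed

lemma residue_primroot_of_int_primroot:
  assumes "int_primroot n g" and "[g = int G] (mod int n)"
  shows "residue_primroot n G"
proof -
  have n: "n > 0" using assms(1) by (auto simp: int_primroot_def residue_primroot_def)
  then have int_nat: "int (nat (g mod int n)) = g mod int n" by simp
  have "[int (nat (g mod int n)) = int G] (mod int n)"
    unfolding int_nat cong_def mod_mod_trivial using assms(2) by (simp only: cong_def)
  then have "[nat (g mod int n) = G] (mod n)" by (simp only: cong_int_iff)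
  then show ?thesis using residue_primroot_cong assms(1) unfolding int_primroot_def by blast
qed

theorem theorem6:
  fixes p q e l lp lq :: nat and g h :: int
    and \<beta> \<rho> :: "'a::comm_ring_1" and Kp Kq :: "'a set"
  assumes "prime p" and "prime q" and "p \<noteq> q"
    and "gcd (p - 1) (q - 1) = 4"
    and "e = cyc_e p q"
    and "int_primroot p g" and "int_primroot q g"
    and "[h = g] (mod int p)" and "[h = 1] (mod int q)"
    and "l = ord (p * q) 2" and "lp = ord p 2" and "lq = ord q 2"
    and "galois_ring l (UNIV :: 'a set)"
    and "galois_ring lp Kp" and "galois_ring lq Kq"
    and "has_mult_order \<beta> (p * q)"
    and "\<rho> = poly (cyc_poly p q g h 1) \<beta> + 2 * poly (cyc_poly p q g h 2) \<beta>
              + 3 * poly (cyc_poly p q g h 3) \<beta>"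
  shows "([p = 1] (mod 8) \<and> [q = 5] (mod 8) \<longrightarrow>
           (\<forall>u::nat. Z4_emb (quat_seq p q g h u) =
              2 + 2 * (\<Sum>i < (p - 1) div lp. TR Kp 1 lp (unit_powi \<beta> (int u * g ^ i * int q)))
                + 2 * (\<Sum>i < (q - 1) div lq. TR Kq 1 lq (unit_powi \<beta> (int u * g ^ i * int p)))
                + (\<Sum>j = 0..3. (\<rho> + 2 - of_nat j) *
                     (\<Sum>i < 4 * e div l. TR UNIV 4 l (unit_powi \<beta> (int u * g ^ i * h ^ j))))))
       \<and> ([p = 5] (mod 8) \<and> [q = 1] (mod 8) \<longrightarrow>
           (\<forall>u::nat. Z4_emb (quat_seq p q g h u) =
              2 + (\<Sum>j = 0..3. (\<rho> + 2 - of_nat j) *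
                     (\<Sum>i < 4 * e div l. TR UNIV 4 l (unit_powi \<beta> (int u * g ^ i * h ^ j))))))"
proof -
  \<comment> \<open>Reduction modulo \<open>p * q\<close> keeps the residues modulo both primes and
    modulo the order of \<open>\<beta>\<close>.\<close>
  define G H where "G = nat (g mod int (p * q))" and "H = nat (h mod int (p * q))"
  have pq: "p * q > 0" using assms(1,2) prime_gt_0_nat by simp
  then have g: "[g = int G] (mod int (p * q))" and h: "[h = int H] (mod int (p * q))"
    by (simp_all add: G_def H_def cong_def)
  have g_p: "[g = int G] (mod int p)" and h_p: "[h = int H] (mod int p)"
    using g h by (simp_all add: cong_modulus_mult)
  have g_q: "[g = int G] (mod int q)" and h_q: "[h = int H] (mod int q)"
    using g h cong_modulus_mult[of _ _ "int q" "int p"] by (simp_all add: mult.commute)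
  have "[int H = int G] (mod int p)"
    using assms(8) g_p h_p by (meson cong_sym cong_trans)
  moreover have "[int H = int 1] (mod int q)"
    using assms(9) h_q cong_trans[OF cong_sym] by simp
  ultimately have "[H = G] (mod p)" "[H = 1] (mod q)" by (simp_all only: cong_int_iff)
  then interpret cyclotomic_order_4 p q G H l \<beta>
    using residue_primroot_of_int_primroot[OF assms(6) g_p] residue_primroot_of_int_primroot[OF assms(7) g_q]
      galois_ring_imp_subring[OF assms(13)] assms(1-4,16)
    by (intro cyclotomic_order_4.intro)
  have l: "l = ord (p * q) 2" and e: "e = cyc_e p q" by (fact assms)+
  have combination: "(\<Sum>j = 0..3. (\<rho> + 2 - of_nat j) *
      (\<Sum>i < 4 * e div l. TR UNIV 4 l (unit_powi \<beta> (int u * g ^ i * h ^ j)))) = combination u"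
    if "4 dvd l" for u
  proof -
    have "unit_powi \<beta> (int u * g ^ i * h ^ j) = \<beta> ^ (u * G ^ i * H ^ j)" for i j
      by (rule unit_powi_eq_power[OF order_\<beta>], unfold of_nat_mult[of "u * G ^ i"] of_nat_mult[of u] of_nat_power)
        (intro cong_mult cong_pow cong_refl g h)
    moreover have "\<rho> = cyclotomic_order_4.\<rho> p q G H \<beta>"
      using poly_cyc_poly[OF g h] by (simp add: assms(17) \<rho>_def)
    ultimately show ?thesis by (simp add: combination_def sum_TR_pq[OF l that] e)
  qed
  have trace_p: "(\<Sum>i < (p - 1) div lp. TR Kp 1 lp (unit_powi \<beta> (int u * g ^ i * int q)))
      = (if p dvd u then of_nat (p - 1) else - 1)" for u
  proof -
    have "unit_powi \<beta> (int u * g ^ i * int q) = \<beta> ^ (u * G ^ i * q)" for i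
      by (rule unit_powi_eq_power[OF order_\<beta>], unfold of_nat_mult[of "u * G ^ i"] of_nat_mult[of u] of_nat_power)
        (intro cong_mult cong_pow cong_refl g)
    then show ?thesis using sum_TR_p[OF l] assms(11,14) by simp
  qed
  have trace_q: "(\<Sum>i < (q - 1) div lq. TR Kq 1 lq (unit_powi \<beta> (int u * g ^ i * int p)))
      = (if q dvd u then of_nat (q - 1) else - 1)" for u
  proof -
    have "unit_powi \<beta> (int u * g ^ i * int p) = \<beta> ^ (u * G ^ i * p)" for i
      by (rule unit_powi_eq_power[OF order_\<beta>], unfold of_nat_mult[of "u * G ^ i"] of_nat_mult[of u] of_nat_power)
        (intro cong_mult cong_pow cong_refl g)
    then show ?thesis using sum_TR_q[OF l] assms(12,15) by simp
  qed
  show ?thesis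
  proof (intro conjI impI allI)
    fix u
    assume mod8: "[p = 1] (mod 8) \<and> [q = 5] (mod 8)"
    then have "4 dvd l"
      using four_dvd_ord_2[OF prime_q _ primroot_q] ord_prime_dvd_ord(2) l dvd_trans by blast
    then show "Z4_emb (quat_seq p q g h u) =
              2 + 2 * (\<Sum>i < (p - 1) div lp. TR Kp 1 lp (unit_powi \<beta> (int u * g ^ i * int q)))
                + 2 * (\<Sum>i < (q - 1) div lq. TR Kq 1 lq (unit_powi \<beta> (int u * g ^ i * int p)))
                + (\<Sum>j = 0..3. (\<rho> + 2 - of_nat j) *
                     (\<Sum>i < 4 * e div l. TR UNIV 4 l (unit_powi \<beta> (int u * g ^ i * h ^ j))))"
      using Z4_emb_quat_seq(1)[OF g h] mod8 by (simp only: combination trace_p trace_q)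
  next
    fix u
    assume mod8: "[p = 5] (mod 8) \<and> [q = 1] (mod 8)"
    then have "4 dvd l"
      using four_dvd_ord_2[OF prime_p _ primroot_p] ord_prime_dvd_ord(1) l dvd_trans by blast
    then show "Z4_emb (quat_seq p q g h u) =
              2 + (\<Sum>j = 0..3. (\<rho> + 2 - of_nat j) *
                     (\<Sum>i < 4 * e div l. TR UNIV 4 l (unit_powi \<beta> (int u * g ^ i * h ^ j))))"
      using Z4_emb_quat_seq(2)[OF g h] mod8 by (simp only: combination)
  qed
qed

end
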